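(* Let $F$ be a rational map, and suppose there exist a bicritical rational map $f$ of degree $d\ge3$ and $k\in\mathbb{N}$ with $f^k=F$. Then every element of $\mathrm{Deck}(F)$ of order at least $3$ has fixed point set exactly $\mathcal{C}_f$ (and such elements exist), and $$\mathcal{V}_f = \{x\in\hat{\mathbb{C}} : F^{-1}(x)\subseteq \mathcal{C}_F\}.$$
   Context: A rational map of degree $d\ge2$ is bicritical if it has exactly two critical points. $\mathcal{C}_h$ denotes the set of critical points of a rational map $h$ and $\mathcal{V}_h$ its set of critical values. $\mathrm{Deck}(F)=\{\tau \text{ Möbius} : F\circ\tau=F\}$. *)

theory Defs
  imports "HOL-Computational_Algebra.Polynomial"
    "HOL-Computational_Algebra.Polynomial_Factorial" Complex_Main
begin

text \<open>The Riemann sphere is modelled as \<open>complex option\<close>; \<open>None\<close> is the point at infinity.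
A rational map is given by a pair of coprime polynomials \<open>(p, q)\<close>, \<open>F = p/q\<close>,
of degree \<open>max (degree p) (degree q) \<ge> 1\<close>.\<close>

type_synonym sphere = "complex option"

definition rdeg :: "complex poly \<Rightarrow> complex poly \<Rightarrow> nat" where
  "rdeg p q = max (degree p) (degree q)"

definition rat_rep :: "complex poly \<Rightarrow> complex poly \<Rightarrow> bool" where
  "rat_rep p q \<longleftrightarrow> coprime p q \<and> rdeg p q \<ge> 1"

text \<open>Homogeneous reversal: \<open>z^d p(1/z)\<close>, giving the chart at infinity.\<close>
definition hrev :: "nat \<Rightarrow> complex poly \<Rightarrow> complex poly" where
  "hrev d p = reflect_poly p * monom 1 (d - degree p)"

definition eval_fin :: "complex poly \<Rightarrow> complex poly \<Rightarrow> complex \<Rightarrow> sphere" where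
  "eval_fin p q a = (if poly q a \<noteq> 0 then Some (poly p a / poly q a) else None)"

definition rat_eval :: "complex poly \<Rightarrow> complex poly \<Rightarrow> sphere \<Rightarrow> sphere" where
  "rat_eval p q z = (case z of
      Some a \<Rightarrow> eval_fin p q a
    | None \<Rightarrow> eval_fin (hrev (rdeg p q) p) (hrev (rdeg p q) q) 0)"

text \<open>Local degree (multiplicity of the point as a solution of \<open>F(w) = F(z)\<close>) in a finite chart.\<close>
definition locdeg_fin :: "complex poly \<Rightarrow> complex poly \<Rightarrow> complex \<Rightarrow> nat" where
  "locdeg_fin p q a = (if poly q a \<noteq> 0
      then order a (p - smult (poly p a / poly q a) q)
      else order a q)"

definition local_deg :: "complex poly \<Rightarrow> complex poly \<Rightarrow> sphere \<Rightarrow> nat" where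
  "local_deg p q z = (case z of
      Some a \<Rightarrow> locdeg_fin p q a
    | None \<Rightarrow> locdeg_fin (hrev (rdeg p q) p) (hrev (rdeg p q) q) 0)"

definition is_rational_map :: "(sphere \<Rightarrow> sphere) \<Rightarrow> bool" where
  "is_rational_map F \<longleftrightarrow> (\<exists>p q. rat_rep p q \<and> F = rat_eval p q)"

definition has_degree :: "(sphere \<Rightarrow> sphere) \<Rightarrow> nat \<Rightarrow> bool" where
  "has_degree F d \<longleftrightarrow> (\<exists>p q. rat_rep p q \<and> F = rat_eval p q \<and> rdeg p q = d)"

definition crit :: "(sphere \<Rightarrow> sphere) \<Rightarrow> sphere set" where
  "crit F = {z. \<exists>p q. rat_rep p q \<and> F = rat_eval p q \<and> local_deg p q z \<ge> 2}"

definition crit_values :: "(sphere \<Rightarrow> sphere) \<Rightarrow> sphere set" where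
  "crit_values F = F ` crit F"

definition bicritical :: "(sphere \<Rightarrow> sphere) \<Rightarrow> bool" where
  "bicritical f \<longleftrightarrow> (\<exists>d\<ge>2. has_degree f d) \<and> card (crit f) = 2"

definition mobius :: "(sphere \<Rightarrow> sphere) \<Rightarrow> bool" where
  "mobius \<tau> \<longleftrightarrow> has_degree \<tau> 1"

definition Deck :: "(sphere \<Rightarrow> sphere) \<Rightarrow> (sphere \<Rightarrow> sphere) set" where
  "Deck F = {\<tau>. mobius \<tau> \<and> F \<circ> \<tau> = F}"

end

(* A normal form f = M o (z^d) o N with Moebius maps M, N comes from counting zeros of the
   Wronskian of f.  The group G = Deck(F) is finite, each of its non-identity elements has exactly
   two fixed points, and G acts freely on a generic fibre of F, so |G| divides d^k.  The rotations
   of f give stabilisers of order at least d at the two critical points of f.  Counting pairs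
   (g, z) with g z = z then excludes the polyhedral groups, and the only points with stabiliser
   of order at least 3 are the critical points of f.

   For the critical values: a point x outside V_f has d >= 3 preimages under f, none critical and
   at most two of them in V_f, so x has arbitrarily long backward orbits avoiding the critical
   points. *)

theory Submission
  imports Defs
    "HOL-Computational_Algebra.Fundamental_Theorem_Algebra"
    "HOL-Computational_Algebra.Primes"
begin

section \<open>Finite transformation groups\<close>

text \<open>Elements of order two behave differently: for even d and f(z) = (z^d - 1) / (z^d + 1)
  one has f(1/z) = -f(z), so 1/z lies in Deck(f^2), yet it fixes 1 and -1, which are not critical.
  Dihedral groups therefore do occur, and the quantity to bound is the number of points whose
  stabiliser has order at least 3. An element of order at least 3 puts itself, its square and the
  identity into the stabiliser of each of its fixed points. The divisibility of d^k by |G| enters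
  through the primes 2 and 3 alone: if one of them divides |G|, it divides d. The second obstacle is
  that \<open>crit\<close> speaks of coprime polynomials, whereas F is given as an iterate.
  Criticality is therefore rewritten as the vanishing of a derivative in charts, a statement about
  the function alone. The chain rule then yields the critical points of F, and no polynomials are
  computed for a composition.\<close>

locale finite_transformation_group =
  fixes G :: "('a \<Rightarrow> 'a) set"
  assumes finite_G: "finite G"
    and id_mem: "id \<in> G"
    and comp_mem: "g \<in> G \<Longrightarrow> h \<in> G \<Longrightarrow> g \<circ> h \<in> G"
    and left_inverse: "g \<in> G \<Longrightarrow> \<exists>h\<in>G. h \<circ> g = id"
begin

section \<open>Orbits and stabilisers\<close>

definition orb :: "'a \<Rightarrow> 'a set" where "orb z = (\<lambda>g. g z) ` G"

definition stab_card :: "'a \<Rightarrow> nat" where "stab_card z = card {g\<in>G. g z = z}"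

text \<open>Left inverses in a monoid of maps are two-sided: if h' is a left inverse of h and h one
  of g, then h' = h' h g = g.\<close>

lemma inverse_mem:
  assumes "g \<in> G"
  obtains h where "h \<in> G" "h \<circ> g = id" "g \<circ> h = id"
proof -
  obtain h where h: "h \<in> G" "h \<circ> g = id" using left_inverse assms by blast
  obtain h' where h': "h' \<in> G" "h' \<circ> h = id" using left_inverse h by blast
  have "h' = (h' \<circ> h) \<circ> g" using h(2) by (simp add: comp_assoc)
  then have "h' = g" using h' by simp
  then show thesis using that h h' by blast
qed

lemma finite_orb [simp]: "finite (orb z)"
  by (simp add: orb_def finite_G)

lemma orb_refl: "z \<in> orb z"
  unfolding orb_def by (rule image_eqI[where x = id]) (use id_mem in auto)

lemma orb_eq:
  assumes "w \<in> orb z" shows "orb w = orb z"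
proof -
  obtain g where g: "g \<in> G" "w = g z" using assms by (auto simp: orb_def)
  obtain h where h: "h \<in> G" "h \<circ> g = id" using inverse_mem g(1) by metis
  have hw: "h w = z" using h g by (metis comp_apply id_apply)
  show ?thesis
  proof (intro subset_antisym subsetI)
    fix x assume "x \<in> orb w"
    then obtain k where "k \<in> G" "x = (k \<circ> g) z" using g by (auto simp: orb_def)
    then show "x \<in> orb z" using comp_mem g(1) unfolding orb_def by blast
  next
    fix x assume "x \<in> orb z"
    then obtain k where "k \<in> G" "x = (k \<circ> h) w" using hw by (auto simp: orb_def)
    then show "x \<in> orb w" using comp_mem h(1) unfolding orb_def by blast
  qed
qed

lemma orb_disjoint: "orb z \<noteq> orb w \<Longrightarrow> orb z \<inter> orb w = {}"
  using orb_eq by blast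

text \<open>Orbit-stabiliser theorem: the elements carrying z to k z are the products of k with the
  elements of the stabiliser of z, so every point of the orbit is hit equally often.\<close>

lemma card_orb_mult_stab: "card (orb z) * stab_card z = card G"
proof -
  let ?f = "\<lambda>g. g z"
  have fib: "card {g\<in>G. g z = w} = stab_card z" if "w \<in> orb z" for w
  proof -
    obtain k where k: "k \<in> G" "w = k z" using \<open>w \<in> orb z\<close> by (auto simp: orb_def)
    obtain h where h: "h \<in> G" "h \<circ> k = id" "k \<circ> h = id" using inverse_mem k(1) by metis
    have hk: "h (k x) = x" "k (h x) = x" for x using h by (metis comp_apply id_apply)+
    have "bij_betw (\<lambda>g. k \<circ> g) {g\<in>G. g z = z} {g\<in>G. g z = w}"
      by (rule bij_betw_byWitness[where f' = "\<lambda>g. h \<circ> g"])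
        (auto simp: hk k comp_mem h(1) fun_eq_iff intro: comp_mem k(1))
    then show ?thesis unfolding stab_card_def by (rule bij_betw_same_card[symmetric])
  qed
  have "card G = (\<Sum>w\<in>orb z. card {g\<in>G. g z = w})"
    using sum.image_gen[OF finite_G, of "\<lambda>_. 1::nat" ?f] by (simp add: orb_def)
  also have "\<dots> = card (orb z) * stab_card z" by (simp add: fib)
  finally show ?thesis by simp
qed

lemma card_G_pos: "0 < card G"
  using finite_G id_mem card_gt_0_iff by blast

lemma stab_card_pos: "0 < stab_card z"
  using card_orb_mult_stab[of z] card_G_pos by (cases "stab_card z") auto

lemma card_orb_pos: "0 < card (orb z)"
  using card_orb_mult_stab[of z] card_G_pos by (cases "card (orb z)") auto

lemma stab_card_orb:
  assumes "w \<in> orb z" shows "stab_card w = stab_card z"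
  using card_orb_mult_stab[of w] card_orb_mult_stab[of z] orb_eq[OF assms] card_orb_pos[of z]
  by (metis mult_left_cancel less_not_refl)

text \<open>Orbits partition \<open>S\<close>. This serves twice: for a free action, with
  \<open>m = card G\<close>, and for the points whose stabiliser has order two, with m half of
  \<open>card G\<close>.\<close>

lemma dvd_card_invariant:
  assumes "finite S" "\<And>z. z \<in> S \<Longrightarrow> orb z \<subseteq> S" "\<And>z. z \<in> S \<Longrightarrow> card (orb z) = m"
  shows "m dvd card S"
proof -
  have U: "\<Union>(orb ` S) = S" using assms(2) orb_refl by blast
  have "m * card (orb ` S) = card (\<Union>(orb ` S))"
    by (intro card_partition) (auto simp: U assms dest: orb_eq)
  then show ?thesis using U by (metis dvd_triv_left)
qed

lemma card_G_dvd_free: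
  assumes "finite S" "\<And>z g. z \<in> S \<Longrightarrow> g \<in> G \<Longrightarrow> g z \<in> S"
    and "\<And>z g. z \<in> S \<Longrightarrow> g \<in> G \<Longrightarrow> g z = z \<Longrightarrow> g = id"
  shows "card G dvd card S"
proof (rule dvd_card_invariant)
  fix z assume z: "z \<in> S"
  then have "{g\<in>G. g z = z} = {id}" using assms(3) id_mem by auto
  then have "stab_card z = 1" by (simp add: stab_card_def)
  then show "card (orb z) = card G" using card_orb_mult_stab[of z] by simp
qed (use assms in \<open>auto simp: orb_def\<close>)

section \<open>Counting fixed points of nontrivial elements\<close>

lemma sum_stab_card:
  assumes fix2: "\<And>g. g \<in> G \<Longrightarrow> g \<noteq> id \<Longrightarrow> card {z. g z = z} = 2"
  defines "X \<equiv> {z. 2 \<le> stab_card z}"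
  shows "finite X" and "(\<Sum>z\<in>X. stab_card z - 1) = 2 * (card G - 1)"
proof -
  have fin: "finite {z. g z = z}" if "g \<in> G - {id}" for g
    using fix2[of g] that by (intro card_ge_0_finite) auto
  have X: "X = (\<Union>g\<in>G - {id}. {z. g z = z})"
  proof (intro equalityI subsetI)
    fix z assume "z \<in> X"
    then have "2 \<le> card {g\<in>G. g z = z}" by (simp add: X_def stab_card_def)
    then have "\<not> {g\<in>G. g z = z} \<subseteq> {id}" using card_mono[of "{id}" "{g\<in>G. g z = z}"] by auto
    then show "z \<in> (\<Union>g\<in>G - {id}. {z. g z = z})" by auto
  next
    fix z assume "z \<in> (\<Union>g\<in>G - {id}. {z. g z = z})"
    then obtain g where "g \<in> G" "g \<noteq> id" "g z = z" by auto
    then have "{id, g} \<subseteq> {g\<in>G. g z = z}" using id_mem by auto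
    then have "card {id, g} \<le> stab_card z"
      unfolding stab_card_def by (intro card_mono) (auto simp: finite_G)
    then show "z \<in> X" using \<open>g \<noteq> id\<close> by (auto simp: X_def)
  qed
  show finX: "finite X" unfolding X using finite_G fin by auto
  \<comment> \<open>Double count of the pairs (g, z) with g not the identity and g z = z: a point z
    lies in \<open>stab_card z - 1\<close> of them, an element g in exactly two.\<close>
  have "(\<Sum>z\<in>X. stab_card z - 1) = (\<Sum>z\<in>X. card {g\<in>G - {id}. g z = z})"
  proof (rule sum.cong)
    fix z assume "z \<in> X"
    have "{g\<in>G - {id}. g z = z} = {g\<in>G. g z = z} - {id}" by auto
    then show "stab_card z - 1 = card {g\<in>G - {id}. g z = z}"
      using id_mem finite_G by (simp add: stab_card_def)
  qed simp
  also have "\<dots> = (\<Sum>z\<in>X. \<Sum>g\<in>G - {id}. if g z = z then 1 else 0)"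
    using finite_G by (simp add: sum.If_cases Int_def)
  also have "\<dots> = (\<Sum>g\<in>G - {id}. \<Sum>z\<in>X. if g z = z then 1 else 0)"
    by (rule sum.swap)
  also have "\<dots> = (\<Sum>g\<in>G - {id}. 2)"
  proof (rule sum.cong)
    fix g assume g: "g \<in> G - {id}"
    then have "X \<inter> {z. g z = z} = {z. g z = z}" using X by auto
    then show "(\<Sum>z\<in>X. if g z = z then 1 else 0) = (2::nat)"
      using fix2[of g] g finX by (simp add: sum.If_cases)
  qed simp
  also have "\<dots> = 2 * (card G - 1)" using id_mem finite_G by simp
  finally show "(\<Sum>z\<in>X. stab_card z - 1) = 2 * (card G - 1)" .
qed

text \<open>An orbit of m points with stabilisers of order n has m n = |G|, so it contributes m (n -
  1) = |G| - m. This is |G| (1 - 1/n) written without division.\<close>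

lemma sum_stab_card_orb: "(\<Sum>w\<in>orb z. stab_card w - 1) = card G - card (orb z)"
proof -
  have "(\<Sum>w\<in>orb z. stab_card w - 1) = card (orb z) * (stab_card z - 1)"
    by (simp add: stab_card_orb)
  then show ?thesis
    by (simp add: card_orb_mult_stab diff_mult_distrib2)
qed

text \<open>The count that usually classifies the finite rotation groups: the orbits of points with
  nontrivial stabilisers of orders \<open>n\<^sub>1, n\<^sub>2, \<dots>\<close> satisfy
  \<open>\<Sum>(1 - 1/n\<^sub>i) = 2 - 2/|G|\<close>.  The divisibility hypotheses exclude the polyhedral
  triples \<open>(2,3,3)\<close>, \<open>(2,3,4)\<close>, \<open>(2,3,5)\<close>, because they force \<open>6\<close> to divide \<open>d\<close>.\<close>

lemma card_large_stabilizer: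
  assumes fix2: "\<And>g. g \<in> G \<Longrightarrow> g \<noteq> id \<Longrightarrow> card {z. g z = z} = 2"
    and d: "3 \<le> d" "d \<le> stab_card c"
    and dvd2: "2 dvd card G \<Longrightarrow> 2 dvd d" and dvd3: "3 dvd card G \<Longrightarrow> 3 dvd d"
  shows "card {z. 3 \<le> stab_card z} \<le> 2"
proof -
  define X where "X = {z. 2 \<le> stab_card z}"
  define N where "N = card G"
  note sums = sum_stab_card[OF fix2, folded X_def N_def]
  have finX: "finite X" and sumX: "(\<Sum>z\<in>X. stab_card z - 1) = 2 * (N - 1)"
    using sums by auto
  have orbX: "orb z \<subseteq> X" if "z \<in> X" for z
    using that stab_card_orb by (auto simp: X_def)
  have os: "card (orb z) * stab_card z = N" for z using card_orb_mult_stab N_def by simp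
  have so: "(\<Sum>w\<in>orb z. stab_card w - 1) = N - card (orb z)" for z
    using sum_stab_card_orb N_def by simp
  have mle: "card (orb z) \<le> N" for z
    using os[of z] stab_card_pos[of z] by (metis mult_le_mono2 nat_mult_1_right One_nat_def Suc_leI)
  have m_le: "k * card (orb z) \<le> N" if "k \<le> stab_card z" for z k
    using os[of z] mult_le_mono1[OF that, of "card (orb z)"] by (simp add: mult.commute)
  have Npos: "0 < N" using card_G_pos N_def by simp
  have stab_dvd: "stab_card z dvd N" for z using os[of z] by (metis dvd_triv_right)
  have cX: "c \<in> X" using d by (simp add: X_def)
  define m1 where "m1 = card (orb c)"
  have m1: "d * m1 \<le> N" "0 < m1" "m1 \<le> N" using m_le d card_orb_pos mle by (auto simp: m1_def)
  show ?thesis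
  \<comment> \<open>Either the orbit of c carries all stabilisers of order at least 3 (cyclic or
    dihedral pattern), or there is a second such orbit.\<close>
  proof (cases "{z. 3 \<le> stab_card z} \<subseteq> orb c")
    case True
    have eq: "orb c = {z. 3 \<le> stab_card z}"
      using True stab_card_orb d by auto
    define S where "S = {z. stab_card z = 2}"
    have XS: "X = orb c \<union> S" "orb c \<inter> S = {}" by (auto simp: X_def S_def eq)
    then have finS: "finite S" using finX by auto
    have "(\<Sum>z\<in>X. stab_card z - 1) = (N - m1) + (\<Sum>z\<in>S. stab_card z - 1)"
      unfolding XS(1) using XS(2) finS so[of c] by (simp add: sum.union_disjoint m1_def)
    then have cS: "(N - m1) + card S = 2 * (N - 1)" using sumX by (simp add: S_def)
    show ?thesis
    proof (rule ccontr)
      assume "\<not> ?thesis"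
      \<comment> \<open>By \<open>cS\<close>, |S| = N + m1 - 2 > N. As \<open>S\<close> consists of
        orbits of size N/2, it has at least 3N/2 points, which exceeds N + m1 - 2 because m1 is at
        most N/3.\<close>
      then have m13: "3 \<le> m1" using eq by (simp add: m1_def)
      have "3 * m1 \<le> N" using m1 d by (meson mult_le_mono1 order_trans)
      have "card S > N" using cS m13 m1 Npos by linarith
      then have "S \<noteq> {}" using Npos by auto
      then obtain b where b: "stab_card b = 2" by (auto simp: S_def)
      have "2 * card (orb z) = N" if "z \<in> S" for z using os[of z] that by (simp add: S_def)
      moreover have "2 * card (orb b) = N" using os[of b] b by simp
      ultimately have "card (orb z) = card (orb b)" if "z \<in> S" for z using that by fastforce
      then have "card (orb b) dvd card S"
        using finS stab_card_orb by (intro dvd_card_invariant) (auto simp: S_def)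
      then obtain t where t: "card S = card (orb b) * t" by (auto simp: dvd_def)
      have bN: "N = 2 * card (orb b)" using os[of b] b by simp
      have "t \<ge> 3"
      proof (rule ccontr)
        assume "\<not> t \<ge> 3"
        then have "card S \<le> card (orb b) * 2" unfolding t by (intro mult_le_mono2) simp
        then show False using bN \<open>card S > N\<close> by simp
      qed
      then have "card S \<ge> card (orb b) * 3" unfolding t by (intro mult_le_mono2) simp
      then show False using cS bN \<open>3 * m1 \<le> N\<close> m13 by linarith
    qed
  next
    case False
    then obtain a where a: "3 \<le> stab_card a" "a \<notin> orb c" by auto
    define m2 where "m2 = card (orb a)"
    have aX: "a \<in> X" using a by (simp add: X_def)
    have dis: "orb c \<inter> orb a = {}" using a orb_disjoint orb_refl by blast
    have m2: "3 * m2 \<le> N" "0 < m2" "m2 \<le> N" using m_le a card_orb_pos mle by (auto simp: m2_def)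
    define O12 where "O12 = orb c \<union> orb a"
    have O12X: "O12 \<subseteq> X" "finite O12" using orbX aX cX by (auto simp: O12_def)
    have s12: "(\<Sum>z\<in>O12. stab_card z - 1) = (N - m1) + (N - m2)"
      unfolding O12_def using dis so by (simp add: sum.union_disjoint m1_def m2_def)
    have "X \<subseteq> O12"
    proof (rule ccontr)
      assume "\<not> X \<subseteq> O12"
      then obtain b where b: "b \<in> X" "b \<notin> O12" by auto
      define m3 where "m3 = card (orb b)"
      have dis3: "O12 \<inter> orb b = {}" using b orb_disjoint orb_refl unfolding O12_def by blast
      have m3: "2 * m3 \<le> N" using m_le b by (auto simp: m3_def X_def)
      have "(\<Sum>z\<in>O12 \<union> orb b. stab_card z - 1) = (N - m1) + (N - m2) + (N - m3)"
        using dis3 so s12 O12X by (simp add: sum.union_disjoint m3_def)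
      \<comment> \<open>With stabiliser orders n1, n2, n3 the bound \<open>main\<close> says 1/n1 +
        1/n2 + 1/n3 > 1. Only an inequality is available, since further orbits are not excluded
        here.\<close>
      moreover have "(\<Sum>z\<in>O12 \<union> orb b. stab_card z - 1) \<le> (\<Sum>z\<in>X. stab_card z - 1)"
        using O12X orbX b finX by (intro sum_mono2) auto
      ultimately have main: "N + 2 \<le> m1 + m2 + m3"
        using sumX m1 m2 m3 Npos by linarith
      have m13: "3 * m1 \<le> N" using m1 d by (meson mult_le_mono1 order_trans)
      have "\<not> 3 \<le> stab_card b"
      proof
        assume "3 \<le> stab_card b"
        then have "3 * m3 \<le> N" using m_le by (simp add: m3_def)
        then show False using main m13 m2 by linarith
      qed
      \<comment> \<open>From n3 = 2 the order N is even, hence so is d, and n1 is at least 4. That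
        forces n2 = 3, so 3 divides d and n1 is at least 6. But 1/6 + 1/3 + 1/2 is only 1.\<close>
      then have "stab_card b = 2" using b by (simp add: X_def)
      then have "2 dvd d" using stab_dvd[of b] dvd2 N_def by simp
      then have "4 \<le> d" using d by presburger
      then have m14: "4 * m1 \<le> N" using m1 by (meson mult_le_mono1 order_trans)
      have "\<not> 4 \<le> stab_card a"
      proof
        assume "4 \<le> stab_card a"
        then have "4 * m2 \<le> N" using m_le by (simp add: m2_def)
        then show False using main m14 m3 by linarith
      qed
      then have "stab_card a = 3" using a by simp
      then have "3 dvd d" using stab_dvd[of a] dvd3 N_def by simp
      then have "6 \<le> d" using \<open>2 dvd d\<close> d by presburger
      then have m16: "6 * m1 \<le> N" using m1 by (meson mult_le_mono1 order_trans)
      show False using main m16 m2 m3 by linarith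
    qed
    then have XO: "X = O12" using O12X by auto
    \<comment> \<open>Two orbits give (N - m1) + (N - m2) = 2 (N - 1), so both are single points:
      the cyclic case.\<close>
    then have "m1 + m2 = 2" using s12 sumX[unfolded XO] m1 m2 Npos by linarith
    then have "card X = 2" unfolding XO O12_def using dis by (simp add: card_Un_disjoint m1_def m2_def)
    moreover have "{z. 3 \<le> stab_card z} \<subseteq> X" by (auto simp: X_def)
    ultimately show ?thesis using card_mono[OF finX] by metis
  qed
qed

end

section \<open>Homogeneous coordinates and Moebius transformations\<close>

text \<open>The point \<open>[x : y]\<close> of the sphere; the junk value at \<open>x = y = 0\<close> is \<open>None\<close>.\<close>

definition hpt :: "complex \<Rightarrow> complex \<Rightarrow> sphere" where
  "hpt x y = (if y \<noteq> 0 then Some (x / y) else None)"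

text \<open>Normalised coordinates [a : 1] and [1 : 0], which let linear and power maps be written
  without a case distinction at infinity.\<close>

definition hX :: "sphere \<Rightarrow> complex" where "hX z = (case z of Some a \<Rightarrow> a | None \<Rightarrow> 1)"
definition hY :: "sphere \<Rightarrow> complex" where "hY z = (case z of Some a \<Rightarrow> 1 | None \<Rightarrow> 0)"

lemma hXY_simps [simp]: "hX (Some a) = a" "hX None = 1" "hY (Some a) = 1" "hY None = 0"
  by (auto simp: hX_def hY_def)

lemma hXY_nonzero: "hX z \<noteq> 0 \<or> hY z \<noteq> 0"
  by (cases z) auto

lemma hpt_hXY [simp]: "hpt (hX z) (hY z) = z"
  by (cases z) (auto simp: hpt_def)

lemma hpt_scale: "k \<noteq> 0 \<Longrightarrow> hpt (k * x) (k * y) = hpt x y"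
  by (auto simp: hpt_def)

lemma hpt_eq_iff:
  assumes "x \<noteq> 0 \<or> y \<noteq> 0" "u \<noteq> 0 \<or> v \<noteq> 0"
  shows "hpt x y = hpt u v \<longleftrightarrow> x * v = u * y"
  using assms by (auto simp: hpt_def frac_eq_eq)

lemma hpt_coords:
  assumes "x \<noteq> 0 \<or> y \<noteq> 0"
  obtains k where "k \<noteq> 0" "x = k * hX (hpt x y)" "y = k * hY (hpt x y)"
proof (cases "y = 0")
  case True
  then show ?thesis using that[of x] assms by (auto simp: hpt_def)
next
  case False
  then show ?thesis using that[of y] by (auto simp: hpt_def)
qed

definition mob :: "complex \<Rightarrow> complex \<Rightarrow> complex \<Rightarrow> complex \<Rightarrow> sphere \<Rightarrow> sphere" where
  "mob a b c d z = hpt (a * hX z + b * hY z) (c * hX z + d * hY z)"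

text \<open>Two coordinate pairs of the same point differ by a nonzero factor, which passes through
  the linear map and is cancelled by \<open>hpt\<close>.\<close>

lemma mob_hpt:
  assumes "x \<noteq> 0 \<or> y \<noteq> 0"
  shows "mob a b c d (hpt x y) = hpt (a * x + b * y) (c * x + d * y)"
proof -
  obtain k where k: "k \<noteq> 0" "x = k * hX (hpt x y)" "y = k * hY (hpt x y)"
    using hpt_coords[OF assms] by blast
  have "a * x + b * y = k * (a * hX (hpt x y) + b * hY (hpt x y))"
       "c * x + d * y = k * (c * hX (hpt x y) + d * hY (hpt x y))"
    by (subst k(2), subst k(3), simp add: algebra_simps)+
  then show ?thesis using hpt_scale[OF k(1)] by (simp add: mob_def)
qed

text \<open>Cramer's rule. It keeps the pair (0, 0), where \<open>hpt\<close> has a junk value, from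
  arising.\<close>

lemma det_nonzero:
  fixes a b c d x y :: complex
  assumes "a * d - b * c \<noteq> 0" "x \<noteq> 0 \<or> y \<noteq> 0"
  shows "a * x + b * y \<noteq> 0 \<or> c * x + d * y \<noteq> 0"
proof (rule ccontr)
  assume "\<not> ?thesis"
  then have e: "a * x + b * y = 0" "c * x + d * y = 0" by auto
  have "(a * d - b * c) * x = d * (a * x + b * y) - b * (c * x + d * y)"
       "(a * d - b * c) * y = a * (c * x + d * y) - c * (a * x + b * y)"
    by (simp_all add: algebra_simps)
  then show False using e assms by simp
qed

lemma mob_comp:
  assumes "a' * d' - b' * c' \<noteq> 0"
  shows "mob a b c d \<circ> mob a' b' c' d' =
    mob (a * a' + b * c') (a * b' + b * d') (c * a' + d * c') (c * b' + d * d')"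
proof
  fix z
  have "a' * hX z + b' * hY z \<noteq> 0 \<or> c' * hX z + d' * hY z \<noteq> 0"
    using det_nonzero assms hXY_nonzero by blast
  from mob_hpt[OF this, of a b c d] show "(mob a b c d \<circ> mob a' b' c' d') z =
    mob (a * a' + b * c') (a * b' + b * d') (c * a' + d * c') (c * b' + d * d') z"
    by (simp add: mob_def[of a' b' c' d'] mob_def[of "a * a' + b * c'"] algebra_simps)
qed

lemma mob_scalar: "a \<noteq> 0 \<Longrightarrow> mob a 0 0 a = id"
  by (rule ext) (simp add: mob_def hpt_scale)

section \<open>Rational maps in homogeneous coordinates\<close>

text \<open>For \<open>degree p \<le> d\<close> this is the form y^d p(x/y) at the normalised
  coordinates of z. At [1 : 0] the only surviving term is the coefficient of x^d.\<close>

definition hev :: "nat \<Rightarrow> complex poly \<Rightarrow> sphere \<Rightarrow> complex" where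
  "hev d p z = (case z of Some a \<Rightarrow> poly p a | None \<Rightarrow> coeff p d)"

lemma hev_simps [simp]: "hev d p (Some a) = poly p a" "hev d p None = coeff p d"
  by (auto simp: hev_def)

text \<open>Coprimality is expressed as the absence of common zeros on the sphere, infinity
  included. This form passes pointwise through changes of coordinate.\<close>

definition hrep :: "nat \<Rightarrow> complex poly \<Rightarrow> complex poly \<Rightarrow> bool" where
  "hrep d p q \<longleftrightarrow> 1 \<le> d \<and> degree p \<le> d \<and> degree q \<le> d \<and>
     (\<forall>z. hev d p z \<noteq> 0 \<or> hev d q z \<noteq> 0)"

definition hmap :: "nat \<Rightarrow> complex poly \<Rightarrow> complex poly \<Rightarrow> sphere \<Rightarrow> sphere" where
  "hmap d p q z = hpt (hev d p z) (hev d q z)"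

lemma coeff_hrev:
  assumes "degree p \<le> d"
  shows "coeff (hrev d p) i = (if i \<le> d then coeff p (d - i) else 0)"
proof -
  have "hrev d p = monom 1 (d - degree p) * reflect_poly p" by (simp add: hrev_def mult.commute)
  then have "coeff (hrev d p) i =
      (if i < d - degree p then 0 else coeff (reflect_poly p) (i - (d - degree p)))"
    by (simp add: coeff_monom_mult)
  also have "\<dots> = (if i \<le> d then coeff p (d - i) else 0)"
  proof (cases "i < d - degree p")
    case True
    then show ?thesis by (simp add: coeff_eq_0)
  next
    case False
    then have "i - (d - degree p) > degree p \<longleftrightarrow> i > d"
      "i \<le> d \<Longrightarrow> degree p - (i - (d - degree p)) = d - i"
      using assms by auto
    then show ?thesis using False by (auto simp: coeff_reflect_poly not_less)
  qed
  finally show ?thesis .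
qed

lemma degree_hrev: "degree p \<le> d \<Longrightarrow> degree (hrev d p) \<le> d"
  by (intro degree_le) (auto simp: coeff_hrev)

lemma poly_hrev:
  assumes "degree p \<le> d" "t \<noteq> 0"
  shows "poly (hrev d p) t = t ^ d * poly p (1 / t)"
proof -
  have "poly (hrev d p) t = t ^ degree p * poly p (inverse t) * t ^ (d - degree p)"
    by (simp add: hrev_def poly_monom poly_reflect_poly_nz assms)
  also have "\<dots> = t ^ (degree p + (d - degree p)) * poly p (1 / t)"
    by (simp add: power_add inverse_eq_divide)
  finally show ?thesis using assms by simp
qed

lemma poly_hrev_0: "degree p \<le> d \<Longrightarrow> poly (hrev d p) 0 = coeff p d"
  by (simp add: poly_0_coeff_0 coeff_hrev)

lemma eval_fin_hpt: "eval_fin p q a = hpt (poly p a) (poly q a)"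
  by (simp add: eval_fin_def hpt_def)

lemma rat_eval_hmap: "rat_eval p q = hmap (rdeg p q) p q"
proof
  fix z
  have "degree p \<le> rdeg p q" "degree q \<le> rdeg p q" by (auto simp: rdeg_def)
  then show "rat_eval p q z = hmap (rdeg p q) p q z"
    by (cases z) (auto simp: rat_eval_def eval_fin_hpt hmap_def poly_hrev_0)
qed

lemma rat_rep_hrep: assumes "rat_rep p q" shows "hrep (rdeg p q) p q"
proof -
  have c: "coprime p q" "1 \<le> rdeg p q" using assms by (auto simp: rat_rep_def)
  have "hev (rdeg p q) p z \<noteq> 0 \<or> hev (rdeg p q) q z \<noteq> 0" for z
  proof (cases z)
    case None
    then show ?thesis using c(2) by (auto simp: rdeg_def max_def split: if_splits)
  next
    case (Some a)
    then show ?thesis using coprime_poly_0[OF c(1)] by simp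
  qed
  then show ?thesis using c by (auto simp: hrep_def rdeg_def)
qed

lemma has_degree_hmap:
  assumes "has_degree F d"
  obtains p q where "hrep d p q" "F = hmap d p q"
  using assms rat_rep_hrep rat_eval_hmap by (auto simp: has_degree_def)

section \<open>Moebius transformations as invertible matrices, and their fixed points\<close>

lemma mobius_iff: "mobius \<tau> \<longleftrightarrow> (\<exists>a b c d. a * d - b * c \<noteq> 0 \<and> \<tau> = mob a b c d)"
proof
  assume "mobius \<tau>"
  then obtain p q where pq: "hrep 1 p q" "\<tau> = hmap 1 p q"
    unfolding mobius_def by (rule has_degree_hmap)
  define a b c d where "a = coeff p 1" and "b = coeff p 0" and "c = coeff q 1" and "d = coeff q 0"
  have lin: "r = [:coeff r 0, coeff r 1:]" if "degree r \<le> 1" for r :: "complex poly"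
    using that by (intro poly_eqI) (auto simp: coeff_pCons coeff_eq_0 split: nat.splits)
  have p: "p = [:b, a:]" and q: "q = [:d, c:]"
    using pq(1) lin by (auto simp: hrep_def a_def b_def c_def d_def)
  have nz: "hev 1 p z \<noteq> 0 \<or> hev 1 q z \<noteq> 0" for z using pq(1) by (auto simp: hrep_def)
  have ev: "hev 1 p z = a * hX z + b * hY z" "hev 1 q z = c * hX z + d * hY z" for z
    by (cases z; simp add: p q)+
  have nz': "a * hX z + b * hY z \<noteq> 0 \<or> c * hX z + d * hY z \<noteq> 0" for z
    using nz[of z] unfolding ev .
  have "a * d - b * c \<noteq> 0"
  proof
    \<comment> \<open>The two linear forms are now proportional and share a zero: that of the
      numerator if c = d = 0, otherwise that of the denominator, which is infinity for c = 0 and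
      -d/c for other c.\<close>
    assume 0: "a * d - b * c = 0"
    show False
    proof (cases "c = 0 \<and> d = 0")
      case True
      then show False using nz'[of "if a = 0 then None else Some (- b / a)"]
        by (auto split: if_splits)
    next
      case cd: False
      then show False
      proof (cases "c = 0")
        case True
        then have "a = 0" using 0 cd by simp
        then show False using nz'[of None] True by auto
      next
        case False
        then have "a * (- d / c) + b = 0" using 0 by (simp add: field_simps)
        then show False using nz'[of "Some (- d / c)"] False by auto
      qed
    qed
  qed
  moreover have "\<tau> = mob a b c d"
    by (rule ext) (simp add: pq(2) hmap_def mob_def ev[simplified])
  ultimately show "\<exists>a b c d. a * d - b * c \<noteq> 0 \<and> \<tau> = mob a b c d" by blast
next
  assume "\<exists>a b c d. a * d - b * c \<noteq> 0 \<and> \<tau> = mob a b c d"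
  then obtain a b c d where m: "a * d - b * c \<noteq> 0" "\<tau> = mob a b c d" by blast
  let ?p = "[:b, a:]" and ?q = "[:d, c:]"
  have "coprime ?p ?q"
  proof (rule coprimeI)
    fix r assume "r dvd ?p" "r dvd ?q"
    \<comment> \<open>Eliminating the variable leaves the determinant, a unit.\<close>
    then have "r dvd smult a ?q - smult c ?p" by (intro dvd_diff dvd_smult)
    also have "smult a ?q - smult c ?p = [:a * d - b * c:]" by (simp add: mult.commute)
    finally show "is_unit r" using m(1) dvd_trans[of r _ 1] by (simp add: is_unit_triv)
  qed
  moreover have deg: "rdeg ?p ?q = 1" using m(1) by (auto simp: rdeg_def)
  moreover have "hmap 1 ?p ?q = mob a b c d"
  proof
    fix z show "hmap 1 ?p ?q z = mob a b c d z"
      by (cases z) (simp_all add: hmap_def mob_def add.commute mult.commute)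
  qed
  ultimately show "mobius \<tau>"
    unfolding mobius_def has_degree_def rat_rep_def
    using m(2) rat_eval_hmap[of ?p ?q] by (metis order_refl)
qed

lemma mobius_mob: "a * d - b * c \<noteq> 0 \<Longrightarrow> mobius (mob a b c d)"
  using mobius_iff by blast

lemma mobius_id: "mobius id"
  using mobius_mob[of 1 1 0 0] mob_scalar[of 1] by simp

lemma mobius_comp:
  assumes "mobius \<sigma>" "mobius \<tau>" shows "mobius (\<sigma> \<circ> \<tau>)"
proof -
  obtain a b c d a' b' c' d' where m: "a * d - b * c \<noteq> 0" "\<sigma> = mob a b c d"
    "a' * d' - b' * c' \<noteq> 0" "\<tau> = mob a' b' c' d'" using assms mobius_iff by metis
  have "(a * a' + b * c') * (c * b' + d * d') - (a * b' + b * d') * (c * a' + d * c') =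
    (a * d - b * c) * (a' * d' - b' * c')" by (simp add: algebra_simps)
  then have "(a * a' + b * c') * (c * b' + d * d') - (a * b' + b * d') * (c * a' + d * c') \<noteq> 0"
    using m by simp
  then show ?thesis using mobius_mob unfolding m(2,4) mob_comp[OF m(3)] by blast
qed

lemma mobius_inverse:
  assumes "mobius \<tau>"
  obtains \<sigma> where "mobius \<sigma>" "\<sigma> \<circ> \<tau> = id" "\<tau> \<circ> \<sigma> = id"
proof -
  obtain a b c d where m: "a * d - b * c \<noteq> 0" "\<tau> = mob a b c d" using assms mobius_iff by metis
  have m': "d * a - (- b) * (- c) \<noteq> 0" using m(1) by (simp add: mult.commute)
  have "mob d (- b) (- c) a \<circ> \<tau> = mob (a * d - b * c) 0 0 (a * d - b * c)"
    "\<tau> \<circ> mob d (- b) (- c) a = mob (a * d - b * c) 0 0 (a * d - b * c)"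
    unfolding m(2) mob_comp[OF m(1)] mob_comp[OF m'] by (simp_all add: algebra_simps)
  then show ?thesis using that[of "mob d (- b) (- c) a"] mobius_mob[OF m'] mob_scalar[OF m(1)] by simp
qed

lemma mobius_bij: "mobius \<tau> \<Longrightarrow> bij \<tau>"
  using mobius_inverse o_bij by metis

lemma mobius_has_fixed_point:
  assumes "mobius \<tau>" shows "\<exists>z. \<tau> z = z"
proof -
  obtain a b c d where m: "a * d - b * c \<noteq> 0" "\<tau> = mob a b c d" using assms mobius_iff by metis
  show ?thesis
  proof (cases "c = 0")
    case True
    then have "\<tau> None = None" by (simp add: m mob_def hpt_def)
    then show ?thesis by blast
  next
    case False
    \<comment> \<open>A square root of the discriminant of c z^2 + (d - a) z - b, the equation for
      finite fixed points.\<close>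
    define s where "s = csqrt ((a - d)\<^sup>2 + 4 * b * c)"
    define z where "z = (a - d + s) / (2 * c)"
    have s: "s * s = (a - d) * (a - d) + 4 * b * c" unfolding s_def
      by (metis power2_csqrt power2_eq_square)
    have "2 * c * z = a - d + s" using False by (simp add: z_def)
    then have "(2 * c * z - (a - d)) * (2 * c * z - (a - d)) = s * s" by simp
    then have "4 * c * (a * z + b) = 4 * c * (z * (c * z + d))"
      unfolding s by (simp add: algebra_simps)
    then have e: "a * z + b = z * (c * z + d)" using False by simp
    have "a * z + b * 1 \<noteq> 0 \<or> c * z + d * 1 \<noteq> 0" using det_nonzero[OF m(1), of z 1] by simp
    then have "hpt (a * z + b) (c * z + d) = hpt z 1" using e by (subst hpt_eq_iff) auto
    then have "\<tau> (Some z) = Some z" by (simp add: m mob_def) (simp add: hpt_def)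
    then show ?thesis by blast
  qed
qed

lemma mobius_to_infinity: "\<exists>B. mobius B \<and> B z = None"
proof (cases z)
  case None
  then show ?thesis using mobius_id by (intro exI[of _ id]) auto
next
  case (Some r)
  \<comment> \<open>The witness is 1 / (z - r).\<close>
  then show ?thesis
    by (intro exI[of _ "mob 0 1 1 (- r)"]) (auto intro: mobius_mob simp: mob_def hpt_def)
qed

lemma mobius_fixing_infinity:
  assumes "mobius \<tau>" "\<tau> None = None"
  obtains a b where "a \<noteq> 0" "\<And>z. \<tau> (Some z) = Some (a * z + b)"
proof -
  obtain a b c d where m: "a * d - b * c \<noteq> 0" "\<tau> = mob a b c d" using assms mobius_iff by metis
  have c: "c = 0" using assms(2) by (auto simp: m mob_def hpt_def split: if_splits)
  then have "a \<noteq> 0" "d \<noteq> 0" using m(1) by auto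
  then show ?thesis
    by (intro that[of "a / d" "b / d"]) (auto simp: m mob_def hpt_def c add_divide_distrib)
qed

text \<open>Conjugating a fixed point to infinity gives a z + b. For a different from 1 there is a
  second fixed point b / (1 - a). For a = 1 the map is a nontrivial translation, whose powers are
  all distinct, so finiteness of the set of powers excludes it.\<close>

lemma mobius_fixed_points:
  assumes "mobius \<tau>" "\<tau> \<noteq> id"
  shows "finite {z. \<tau> z = z}" and "card {z. \<tau> z = z} \<le> 2"
    and "finite (range (\<lambda>n. \<tau> ^^ n)) \<Longrightarrow> card {z. \<tau> z = z} = 2"
proof -
  obtain r where r: "\<tau> r = r" using mobius_has_fixed_point assms by blast
  obtain B where B: "mobius B" "B r = None" using mobius_to_infinity by blast
  obtain C where C: "mobius C" "C \<circ> B = id" "B \<circ> C = id" using mobius_inverse B(1) by metis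
  have CB: "C (B z) = z" "B (C z) = z" for z using C by (metis comp_apply id_apply)+
  define \<sigma> where "\<sigma> = B \<circ> \<tau> \<circ> C"
  have "\<sigma> None = None" using r B CB by (metis \<sigma>_def comp_apply)
  moreover have "mobius \<sigma>" unfolding \<sigma>_def using B C assms mobius_comp by blast
  ultimately obtain a b where ab: "a \<noteq> 0" "\<And>z. \<sigma> (Some z) = Some (a * z + b)"
    using mobius_fixing_infinity by metis
  have fixeq: "{z. \<tau> z = z} = C ` {z. \<sigma> z = z}"
  proof (intro equalityI subsetI)
    fix z assume "z \<in> {z. \<tau> z = z}"
    then have "\<sigma> (B z) = B z" by (simp add: \<sigma>_def CB)
    then show "z \<in> C ` {z. \<sigma> z = z}" by (intro image_eqI[of _ _ "B z"]) (simp_all add: CB)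
  next
    fix z assume "z \<in> C ` {z. \<sigma> z = z}"
    then obtain w where w: "z = C w" "B (\<tau> (C w)) = w" by (auto simp: \<sigma>_def)
    then show "z \<in> {z. \<tau> z = z}" using CB(1)[of "\<tau> (C w)"] by simp
  qed
  have inj: "inj_on C S" for S by (metis CB(2) inj_onI)
  have cardeq: "card {z. \<tau> z = z} = card {z. \<sigma> z = z}" unfolding fixeq by (rule card_image[OF inj])
  have set: "{z. \<sigma> z = z} = insert None (Some ` {z. a * z + b = z})"
  proof (intro set_eqI)
    fix z show "z \<in> {z. \<sigma> z = z} \<longleftrightarrow> z \<in> insert None (Some ` {z. a * z + b = z})"
      using ab(2) \<open>\<sigma> None = None\<close> by (cases z) auto
  qed
  have nid: "\<sigma> \<noteq> id"
  proof
    assume "\<sigma> = id"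
    then have "\<tau> z = z" for z by (metis CB(1) \<sigma>_def comp_apply id_apply)
    then show False using assms(2) by auto
  qed
  have main: "finite {z. \<sigma> z = z} \<and> card {z. \<sigma> z = z} \<le> 2 \<and>
    (finite (range (\<lambda>n. \<tau> ^^ n)) \<longrightarrow> card {z. \<sigma> z = z} = 2)"
  proof (cases "a = 1")
    case False
    then have "a * z + b = z \<longleftrightarrow> z = b / (1 - a)" for z by (auto simp: field_simps)
    then have "{z. \<sigma> z = z} = {None, Some (b / (1 - a))}" unfolding set by auto
    then show ?thesis by auto
  next
    case True
    have b: "b \<noteq> 0"
    proof
      assume "b = 0"
      then have "\<sigma> z = id z" for z using ab(2) True \<open>\<sigma> None = None\<close> by (cases z) auto
      then show False using nid by auto
    qed
    then have "{z. \<sigma> z = z} = {None}" unfolding set True by auto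
    moreover have "\<not> finite (range (\<lambda>n. \<tau> ^^ n))"
    proof
      assume fin: "finite (range (\<lambda>n. \<tau> ^^ n))"
      have pow: "B ((\<tau> ^^ n) (C (Some 0))) = Some (of_nat n * b)" for n
      proof (induction n)
        case 0
        then show ?case by (simp add: CB)
      next
        case (Suc n)
        have "B ((\<tau> ^^ Suc n) (C (Some 0))) = \<sigma> (B ((\<tau> ^^ n) (C (Some 0))))"
          by (simp add: \<sigma>_def CB)
        then show ?case using Suc ab(2) True by (simp add: algebra_simps)
      qed
      have "inj (\<lambda>n. Some (of_nat n * b))" using b by (auto simp: inj_def)
      then have "infinite (range (\<lambda>n. Some (of_nat n * b)))" using range_inj_infinite by blast
      moreover have "range (\<lambda>n. Some (of_nat n * b)) = (\<lambda>g. B (g (C (Some 0)))) ` range (\<lambda>n. \<tau> ^^ n)"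
        by (auto simp: pow[symmetric] image_def)
      ultimately show False using fin by simp
    qed
    ultimately show ?thesis by auto
  qed
  show "finite {z. \<tau> z = z}" unfolding fixeq using main by simp
  show "card {z. \<tau> z = z} \<le> 2" unfolding cardeq using main by simp
  show "finite (range (\<lambda>n. \<tau> ^^ n)) \<Longrightarrow> card {z. \<tau> z = z} = 2" unfolding cardeq using main by simp
qed

text \<open>The composite of one map with the inverse of the other fixes three points. This rigidity
  is what later makes deck groups finite.\<close>

lemma mobius_eqI:
  assumes "mobius \<sigma>" "mobius \<tau>" "card S = 3" "\<And>z. z \<in> S \<Longrightarrow> \<sigma> z = \<tau> z"
  shows "\<sigma> = \<tau>"
proof -
  obtain \<rho> where \<rho>: "mobius \<rho>" "\<rho> \<circ> \<sigma> = id" "\<sigma> \<circ> \<rho> = id" using mobius_inverse assms(1) by metis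
  have "\<rho> (\<sigma> z) = z" for z using \<rho>(2) by (metis comp_apply id_apply)
  then have "\<rho> (\<tau> z) = z" if "z \<in> S" for z using assms(4)[OF that] by metis
  then have S: "S \<subseteq> {z. (\<rho> \<circ> \<tau>) z = z}" by auto
  have "\<rho> \<circ> \<tau> = id"
  proof (rule ccontr)
    assume "\<rho> \<circ> \<tau> \<noteq> id"
    then have "finite {z. (\<rho> \<circ> \<tau>) z = z}" "card {z. (\<rho> \<circ> \<tau>) z = z} \<le> 2"
      using mobius_fixed_points(1,2)[OF mobius_comp[OF \<rho>(1) assms(2)]] by auto
    then show False using card_mono[OF _ S] assms(3) by linarith
  qed
  then have "\<sigma> \<circ> \<rho> \<circ> \<tau> = \<sigma>" by (simp add: comp_assoc)
  then show ?thesis by (simp add: \<rho>(3))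
qed

section \<open>Critical points as zeros of the derivative in charts\<close>

definition chart :: "sphere \<Rightarrow> complex \<Rightarrow> sphere" where
  "chart z t = (case z of Some a \<Rightarrow> Some (a + t) | None \<Rightarrow> hpt 1 t)"

text \<open>Inverse of \<open>chart z\<close>. At the one point outside the chart it returns 0, the
  same value as at the centre, so that point has to be avoided.\<close>

definition cochart :: "sphere \<Rightarrow> sphere \<Rightarrow> complex" where
  "cochart z w = (case w of None \<Rightarrow> 0 | Some b \<Rightarrow> (case z of Some a \<Rightarrow> b - a | None \<Rightarrow> 1 / b))"

text \<open>The only point outside the chart centred at \<open>z\<close>.\<close>

definition chart_omit :: "sphere \<Rightarrow> sphere" where
  "chart_omit z = (case z of Some a \<Rightarrow> None | None \<Rightarrow> Some 0)"

lemma chart_0 [simp]: "chart z 0 = z"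
  by (cases z) (auto simp: chart_def hpt_def)

lemma chart_cochart: "w \<noteq> chart_omit z \<Longrightarrow> chart z (cochart z w) = w"
  by (cases z; cases w) (auto simp: chart_def cochart_def chart_omit_def hpt_def)

lemma cochart_chart: "cochart z (chart z t) = t"
  by (cases z) (auto simp: chart_def cochart_def hpt_def)

lemma chart_neq_omit: "chart z t \<noteq> chart_omit z"
  by (cases z) (auto simp: chart_def chart_omit_def hpt_def)

lemma cochart_self [simp]: "cochart z z = 0"
  by (cases z) (auto simp: cochart_def)

text \<open>The derivative of F in the charts centred at z and at F z. Each chart depends on its
  centre alone, so the chain rule holds without correction factors. The second clause keeps the junk
  value of \<open>cochart\<close> out of the difference quotient.\<close>

definition has_mult :: "(sphere \<Rightarrow> sphere) \<Rightarrow> sphere \<Rightarrow> complex \<Rightarrow> bool" where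
  "has_mult F z D \<longleftrightarrow>
     ((\<lambda>t. cochart (F z) (F (chart z t))) has_field_derivative D) (at 0) \<and>
     eventually (\<lambda>t. F (chart z t) \<noteq> chart_omit (F z)) (nhds 0)"

lemma has_mult_unique: "has_mult F z D \<Longrightarrow> has_mult F z E \<Longrightarrow> D = E"
  unfolding has_mult_def using DERIV_unique by blast

lemma has_mult_id: "has_mult id z 1"
  by (simp add: has_mult_def cochart_chart chart_neq_omit)

lemma DERIV_transfer:
  assumes "(f has_field_derivative D) (at x)" "eventually (\<lambda>t. f t = g t) (nhds x)"
  shows "(g has_field_derivative D) (at x)"
  using assms DERIV_cong_ev by blast

lemma has_mult_comp:
  assumes F: "has_mult F z D" and G: "has_mult G (F z) E"
  shows "has_mult (G \<circ> F) z (E * D)"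
proof -
  define \<phi> where "\<phi> = (\<lambda>t. cochart (F z) (F (chart z t)))"
  define \<psi> where "\<psi> = (\<lambda>t. cochart (G (F z)) (G (chart (F z) t)))"
  have d\<phi>: "(\<phi> has_field_derivative D) (at 0)" using F by (simp add: has_mult_def \<phi>_def)
  have d\<psi>: "(\<psi> has_field_derivative E) (at (\<phi> 0))"
    using G by (simp add: has_mult_def \<psi>_def \<phi>_def)
  have ev: "eventually (\<lambda>t. chart (F z) (\<phi> t) = F (chart z t)) (nhds 0)"
    using F unfolding has_mult_def \<phi>_def by (auto elim!: eventually_mono simp: chart_cochart)
  \<comment> \<open>Continuity of \<open>\<phi>\<close> at 0, with \<open>\<phi> 0 = 0\<close>,
    allows the second clause of \<open>has_mult\<close> for G to be pulled back to a neighbourhood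
    of z.\<close>
  have "filterlim \<phi> (nhds (\<phi> 0)) (nhds 0)"
    using DERIV_isCont[OF d\<phi>] unfolding isCont_def
    by (simp add: tendsto_at_iff_tendsto_nhds)
  moreover have "\<phi> 0 = 0" by (simp add: \<phi>_def)
  ultimately have lim: "filterlim \<phi> (nhds 0) (nhds 0)" by simp
  have "eventually (\<lambda>t. G (chart (F z) t) \<noteq> chart_omit (G (F z))) (nhds 0)"
    using G by (simp add: has_mult_def)
  then have "eventually (\<lambda>t. G (chart (F z) (\<phi> t)) \<noteq> chart_omit (G (F z))) (nhds 0)"
    using lim by (rule eventually_compose_filterlim)
  then have 1: "eventually (\<lambda>t. (G \<circ> F) (chart z t) \<noteq> chart_omit ((G \<circ> F) z)) (nhds 0)"
    using ev by eventually_elim simp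
  have "((\<lambda>t. \<psi> (\<phi> t)) has_field_derivative E * D) (at 0)"
    by (rule DERIV_chain2[OF d\<psi> d\<phi>])
  moreover have "eventually (\<lambda>t. \<psi> (\<phi> t) = cochart ((G \<circ> F) z) ((G \<circ> F) (chart z t))) (nhds 0)"
    using ev by eventually_elim (simp add: \<psi>_def)
  ultimately have "((\<lambda>t. cochart ((G \<circ> F) z) ((G \<circ> F) (chart z t))) has_field_derivative E * D) (at 0)"
    by (rule DERIV_transfer)
  with 1 show ?thesis by (simp add: has_mult_def)
qed

text \<open>Numerator of the derivative of p/q and, up to sign, of q/p, so it detects critical
  points at poles as well.\<close>

definition wronskian :: "complex poly \<Rightarrow> complex poly \<Rightarrow> complex poly" where
  "wronskian p q = pderiv p * q - p * pderiv q"

lemma eventually_poly_nonzero: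
  assumes "poly Q (s :: complex) \<noteq> 0"
  shows "eventually (\<lambda>t. poly Q (s + t) \<noteq> 0) (nhds 0)"
proof -
  have "isCont (\<lambda>t. poly Q (s + t)) 0" by (intro continuous_intros)
  then have "eventually (\<lambda>t. poly Q (s + t) \<noteq> 0) (at 0)"
    using assms unfolding isCont_def by (intro tendsto_imp_eventually_ne) auto
  then show ?thesis using assms by (simp add: eventually_nhds_conv_at)
qed

text \<open>Here P, Q are either p, q or their reversals, depending on the chart at z. Where Q
  vanishes, the chart at F z is 1/w, so Q/P is differentiated instead and the Wronskian only changes
  sign.\<close>

lemma has_mult_quotient:
  assumes nz: "poly P s \<noteq> 0 \<or> poly Q s \<noteq> 0"
    and F: "\<And>t. F (chart z t) = hpt (poly P (s + t)) (poly Q (s + t))"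
  obtains D where "has_mult F z D" "D = 0 \<longleftrightarrow> poly (wronskian P Q) s = 0"
proof (cases "poly Q s = 0")
  case False
  have Fz: "F z = Some (poly P s / poly Q s)" using F[of 0] False by (simp add: hpt_def)
  define D where "D = (poly (pderiv P) s * poly Q s - poly P s * poly (pderiv Q) s)
    / (poly Q s * poly Q s)"
  have ev: "eventually (\<lambda>t. poly Q (s + t) \<noteq> 0) (nhds 0)" by (rule eventually_poly_nonzero[OF False])
  have "((\<lambda>t. poly P (s + t) / poly Q (s + t) - poly P s / poly Q s) has_field_derivative D) (at 0)"
    unfolding D_def
    by (rule derivative_eq_intros DERIV_chain2[OF poly_DERIV] refl | use False in simp)+
  moreover have "eventually (\<lambda>t. poly P (s + t) / poly Q (s + t) - poly P s / poly Q s =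
     cochart (F z) (F (chart z t))) (nhds 0)"
    using ev by eventually_elim (auto simp: Fz F cochart_def hpt_def)
  ultimately have "((\<lambda>t. cochart (F z) (F (chart z t))) has_field_derivative D) (at 0)"
    by (rule DERIV_transfer)
  moreover have "eventually (\<lambda>t. F (chart z t) \<noteq> chart_omit (F z)) (nhds 0)"
    using ev by eventually_elim (auto simp: Fz F chart_omit_def hpt_def)
  ultimately show thesis
    using that[of D] False by (simp add: has_mult_def D_def wronskian_def)
next
  case True
  have nP: "poly P s \<noteq> 0" using nz True by simp
  have Fz: "F z = None" using F[of 0] True by (simp add: hpt_def)
  define D where "D = (poly (pderiv Q) s * poly P s - poly Q s * poly (pderiv P) s)
    / (poly P s * poly P s)"
  have ev: "eventually (\<lambda>t. poly P (s + t) \<noteq> 0) (nhds 0)" by (rule eventually_poly_nonzero[OF nP])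
  have "((\<lambda>t. poly Q (s + t) / poly P (s + t)) has_field_derivative D) (at 0)"
    unfolding D_def
    by (rule derivative_eq_intros DERIV_chain2[OF poly_DERIV] refl | use nP in simp)+
  moreover have "eventually (\<lambda>t. poly Q (s + t) / poly P (s + t) =
     cochart (F z) (F (chart z t))) (nhds 0)"
    using ev by eventually_elim (auto simp: Fz F cochart_def hpt_def)
  ultimately have "((\<lambda>t. cochart (F z) (F (chart z t))) has_field_derivative D) (at 0)"
    by (rule DERIV_transfer)
  moreover have "eventually (\<lambda>t. F (chart z t) \<noteq> chart_omit (F z)) (nhds 0)"
    using ev by eventually_elim (auto simp: Fz F chart_omit_def hpt_def)
  moreover have "D = - poly (wronskian P Q) s / (poly P s * poly P s)"
    by (simp add: D_def wronskian_def algebra_simps)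
  ultimately show thesis
    using that[of D] nP by (simp add: has_mult_def)
qed

lemma hrep_hrev:
  assumes "hrep d p q" shows "hrep d (hrev d p) (hrev d q)"
proof -
  have deg: "degree p \<le> d" "degree q \<le> d" "1 \<le> d"
    and nz: "\<And>z. hev d p z \<noteq> 0 \<or> hev d q z \<noteq> 0" using assms by (auto simp: hrep_def)
  have "hev d (hrev d p) z \<noteq> 0 \<or> hev d (hrev d q) z \<noteq> 0" for z
  proof (cases z)
    case None
    then show ?thesis using nz[of "Some 0"] deg by (simp add: coeff_hrev poly_0_coeff_0)
  next
    case (Some t)
    then show ?thesis
      using nz[of None] nz[of "Some (1 / t)"] deg
      by (cases "t = 0") (auto simp: poly_hrev_0 poly_hrev)
  qed
  then show ?thesis using deg degree_hrev by (simp add: hrep_def)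
qed

lemma hmap_chart_infinity:
  assumes "hrep d p q"
  shows "hmap d p q (chart None t) = hpt (poly (hrev d p) t) (poly (hrev d q) t)"
proof -
  have deg: "degree p \<le> d" "degree q \<le> d" using assms by (auto simp: hrep_def)
  show ?thesis
  proof (cases "t = 0")
    case True
    then show ?thesis using deg by (simp add: hmap_def poly_hrev_0)
  next
    case False
    then have "hmap d p q (chart None t) = hpt (poly p (1 / t)) (poly q (1 / t))"
      by (simp add: hmap_def chart_def hpt_def)
    then show ?thesis using False deg by (simp add: poly_hrev hpt_scale)
  qed
qed

lemma poly_pderiv_0: "poly (pderiv p) 0 = coeff p 1"
  by (simp add: poly_0_coeff_0 coeff_pderiv)

lemma wronskian_hrev_0:
  assumes "hrep d p q"
  shows "poly (wronskian (hrev d p) (hrev d q)) 0 =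
    coeff p (d - 1) * coeff q d - coeff p d * coeff q (d - 1)"
proof -
  have deg: "degree p \<le> d" "degree q \<le> d" "1 \<le> d" using assms by (auto simp: hrep_def)
  show ?thesis using deg
    by (simp add: wronskian_def poly_pderiv_0 poly_hrev_0 coeff_hrev)
qed

lemma has_mult_hmap:
  assumes "hrep d p q"
  obtains D where "has_mult (hmap d p q) z D"
    "D = 0 \<longleftrightarrow> (case z of Some a \<Rightarrow> poly (wronskian p q) a = 0
       | None \<Rightarrow> poly (wronskian (hrev d p) (hrev d q)) 0 = 0)"
proof (cases z)
  case (Some a)
  have "poly p a \<noteq> 0 \<or> poly q a \<noteq> 0" using assms unfolding hrep_def by (metis hev_simps(1))
  then obtain D where "has_mult (hmap d p q) z D" "D = 0 \<longleftrightarrow> poly (wronskian p q) a = 0"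
    by (rule has_mult_quotient[of p a q "hmap d p q" z]) (simp add: Some hmap_def chart_def)
  then show thesis using that Some by simp
next
  case None
  have "poly (hrev d p) 0 \<noteq> 0 \<or> poly (hrev d q) 0 \<noteq> 0"
    using hrep_hrev[OF assms] unfolding hrep_def by (metis hev_simps(1))
  then obtain D where "has_mult (hmap d p q) z D"
    "D = 0 \<longleftrightarrow> poly (wronskian (hrev d p) (hrev d q)) 0 = 0"
    by (rule has_mult_quotient[of "hrev d p" 0 "hrev d q" "hmap d p q" z])
      (simp add: None hmap_chart_infinity[OF assms])
  then show thesis using that None by simp
qed

text \<open>As a form of degree d >= 1, each of p and q has a zero on the sphere, at infinity if its
  degree drops. At a zero of q the relation reduces to l times a nonzero value of p, and
  symmetrically.\<close>

lemma hrep_independent: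
  assumes "hrep d p q" "smult l p + smult m q = 0"
  shows "l = 0 \<and> m = 0"
proof -
  have root: "\<exists>z. hev d r z = 0" if "degree r \<le> d" "1 \<le> d" for r :: "complex poly"
  proof (cases "degree r < d")
    case True
    then have "hev d r None = 0" by (simp add: coeff_eq_0)
    then show ?thesis by blast
  next
    case False
    then have "\<not> constant (poly r)" using that by (simp add: constant_degree)
    then obtain a where "poly r a = 0" using fundamental_theorem_of_algebra by blast
    then show ?thesis by (intro exI[of _ "Some a"]) simp
  qed
  have deg: "degree p \<le> d" "degree q \<le> d" "1 \<le> d"
    and nz: "\<And>z. hev d p z \<noteq> 0 \<or> hev d q z \<noteq> 0" using assms by (auto simp: hrep_def)
  have lin: "l * hev d p z + m * hev d q z = 0" for z
  proof (cases z)
    case None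
    then show ?thesis using arg_cong[OF assms(2), of "\<lambda>r. coeff r d"] by simp
  next
    case (Some a)
    then show ?thesis using arg_cong[OF assms(2), of "\<lambda>r. poly r a"] by simp
  qed
  obtain z where z: "hev d q z = 0" using root deg by blast
  obtain w where w: "hev d p w = 0" using root deg by blast
  show ?thesis using lin[of z] lin[of w] nz[of z] nz[of w] z w by auto
qed

section \<open>Local degree compared with the derivative\<close>

lemma order_ge_2_iff:
  fixes r :: "complex poly"
  assumes "r \<noteq> 0" "poly r s = 0"
  shows "2 \<le> order s r \<longleftrightarrow> poly (pderiv r) s = 0"
proof -
  have "degree r \<noteq> 0" using assms by (metis degree_eq_zeroE pCons_0_0 poly_const_conv)
  then have "pderiv r \<noteq> 0" by (simp add: pderiv_eq_0_iff)
  then show ?thesis using order_pderiv[OF assms] order_root[of "pderiv r" s] by auto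
qed

text \<open>With v = p(s)/q(s), the derivative of p - v q at s is the Wronskian divided by q(s). At
  a zero of q the Wronskian is -p(s) q'(s).\<close>

lemma locdeg_fin_ge_2_iff:
  assumes "hrep d p q"
  shows "2 \<le> locdeg_fin p q s \<longleftrightarrow> poly (wronskian p q) s = 0"
proof (cases "poly q s = 0")
  case False
  let ?r = "p - smult (poly p s / poly q s) q"
  have "?r \<noteq> 0" using hrep_independent[OF assms, of 1 "- (poly p s / poly q s)"] by auto
  then have "2 \<le> locdeg_fin p q s \<longleftrightarrow> poly (pderiv ?r) s = 0"
    using False order_ge_2_iff[of ?r s] by (simp add: locdeg_fin_def)
  then show ?thesis using False by (simp add: wronskian_def pderiv_diff pderiv_smult field_simps)
next
  case True
  have "poly p s \<noteq> 0" using True assms unfolding hrep_def by (metis hev_simps(1))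
  moreover have "q \<noteq> 0" using hrep_independent[OF assms, of 0 1] by auto
  ultimately show ?thesis using True order_ge_2_iff[of q s] by (simp add: locdeg_fin_def wronskian_def)
qed

lemma local_deg_ge_2_iff:
  assumes "rat_rep p q"
  shows "2 \<le> local_deg p q z \<longleftrightarrow> has_mult (rat_eval p q) z 0"
proof -
  let ?d = "rdeg p q"
  have h: "hrep ?d p q" by (rule rat_rep_hrep[OF assms])
  obtain D where D: "has_mult (hmap ?d p q) z D"
    "D = 0 \<longleftrightarrow> (case z of Some a \<Rightarrow> poly (wronskian p q) a = 0
       | None \<Rightarrow> poly (wronskian (hrev ?d p) (hrev ?d q)) 0 = 0)"
    using has_mult_hmap[OF h] by metis
  have "2 \<le> local_deg p q z \<longleftrightarrow> D = 0"
    unfolding D(2) using locdeg_fin_ge_2_iff[OF h] locdeg_fin_ge_2_iff[OF hrep_hrev[OF h]]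
    by (cases z) (simp_all add: local_deg_def)
  then show ?thesis using D(1) has_mult_unique by (metis rat_eval_hmap)
qed

text \<open>The right-hand side mentions only the function, so criticality does not depend on the
  representation and can be studied on iterates.\<close>

lemma crit_iff_has_mult:
  assumes "is_rational_map F"
  shows "z \<in> crit F \<longleftrightarrow> has_mult F z 0"
  using assms local_deg_ge_2_iff unfolding is_rational_map_def crit_def by blast

section \<open>Normal form of bicritical maps\<close>

text \<open>The term r' u has order e at c, while r u' has order at least e + 1, so nothing cancels
  in lowest order.\<close>

lemma order_wronskian:
  assumes "r \<noteq> 0" "order c r = Suc e" "poly u c \<noteq> 0"
  shows "wronskian r u \<noteq> 0" "order c (wronskian r u) = e"
proof -
  let ?g = "[:- c, 1:]"
  have rc: "poly r c = 0" using assms(1,2) by (simp add: order_root)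
  have "degree r \<noteq> 0" using assms(1) rc by (metis degree_eq_zeroE pCons_0_0 poly_const_conv)
  then have "pderiv r \<noteq> 0" by (simp add: pderiv_eq_0_iff)
  moreover have "u \<noteq> 0" using assms(3) by auto
  ultimately have nz: "pderiv r * u \<noteq> 0" by simp
  have "order c (pderiv r) = e" using order_pderiv[OF assms(1) rc] assms(2) by simp
  then have o: "order c (pderiv r * u) = e" using order_mult[OF nz] assms(3) by (simp add: order_0I)
  have d1: "?g ^ Suc e dvd r * pderiv u" using order_1[of c r] assms(2) by (simp add: dvd_mult2)
  have "?g ^ e dvd ?g ^ Suc e" by (rule le_imp_power_dvd) simp
  then have d2: "?g ^ e dvd wronskian r u"
    unfolding wronskian_def using order_1[of c "pderiv r * u"] dvd_trans[OF _ d1] o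
    by (intro dvd_diff) auto
  have nd: "\<not> ?g ^ Suc e dvd wronskian r u"
  proof
    assume "?g ^ Suc e dvd wronskian r u"
    then have "?g ^ Suc e dvd wronskian r u + r * pderiv u" using d1 by (rule dvd_add)
    then have "?g ^ Suc e dvd pderiv r * u" by (simp add: wronskian_def)
    then show False using order_2[OF nz, of c] o by simp
  qed
  then show "wronskian r u \<noteq> 0" by auto
  show "order c (wronskian r u) = e" using order_unique_lemma[OF d2 nd] by simp
qed

lemma max_order_power:
  assumes "r \<noteq> 0" "degree r \<le> d" "order c r = d"
  shows "\<exists>\<alpha>. \<alpha> \<noteq> 0 \<and> r = smult \<alpha> ([:- c, 1:] ^ d)"
proof -
  obtain s where s: "r = [:- c, 1:] ^ d * s" using order_1[of c r] assms(3) by (auto elim: dvdE)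
  have "s \<noteq> 0" using s assms(1) by auto
  then have "degree r = d + degree s"
    unfolding s by (subst degree_mult_eq) (auto simp: degree_power_eq)
  then have "degree s = 0" using assms(2) by simp
  then obtain \<alpha> where "s = [:\<alpha>:]" by (metis degree_eq_zeroE)
  then show ?thesis using s \<open>s \<noteq> 0\<close> by (intro exI[of _ \<alpha>]) auto
qed

text \<open>The Wronskian is bilinear and alternating, so up to a nonzero factor p, q may be
  replaced by a combination r vanishing at c and a partner u that does not. The order of r is at
  most d, and order d forces r to be a d-th power.\<close>

lemma order_wronskian_hrep:
  assumes "hrep d p q"
  shows "wronskian p q \<noteq> 0" "order c (wronskian p q) \<le> d - 1"
    and "order c (wronskian p q) = d - 1 \<Longrightarrow>
      \<exists>l m \<alpha>. \<alpha> \<noteq> 0 \<and> smult l p + smult m q = smult \<alpha> ([:- c, 1:] ^ d)"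
proof -
  have deg: "degree p \<le> d" "degree q \<le> d" "1 \<le> d"
    and nz: "\<And>z. hev d p z \<noteq> 0 \<or> hev d q z \<noteq> 0" using assms by (auto simp: hrep_def)
  obtain l m u s where u: "poly u c \<noteq> 0" and s: "s \<noteq> 0"
    and lm: "l \<noteq> 0 \<or> m \<noteq> 0" and root: "poly (smult l p + smult m q) c = 0"
    and W: "wronskian (smult l p + smult m q) u = smult s (wronskian p q)"
  proof (cases "poly q c = 0")
    case False
    let ?v = "poly p c / poly q c"
    have "wronskian (smult 1 p + smult (- ?v) q) q = smult 1 (wronskian p q)"
      by (simp add: wronskian_def pderiv_diff pderiv_smult algebra_simps)
    then show thesis using that[of q 1 1 "- ?v"] False by simp
  next
    case True
    have "wronskian (smult 0 p + smult 1 q) p = smult (- 1) (wronskian p q)"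
      by (simp add: wronskian_def algebra_simps)
    then show thesis using that[of p "- 1" 0 1] True nz[of "Some c"] by simp
  qed
  define r where "r = smult l p + smult m q"
  have r0: "r \<noteq> 0" using hrep_independent[OF assms] lm by (auto simp: r_def)
  have degr: "degree r \<le> d" unfolding r_def using deg
    by (intro degree_add_le) (meson degree_smult_le order_trans)+
  have "order c r \<noteq> 0" using root r0 order_root r_def by blast
  then obtain e where e: "order c r = Suc e" using not0_implies_Suc by blast
  have "order c r \<le> d" using order_degree[OF r0] degr by (meson order_trans)
  note ow = order_wronskian[OF r0 e u]
  have Wr: "wronskian r u = smult s (wronskian p q)" using W by (simp add: r_def)
  show "wronskian p q \<noteq> 0" using ow(1) Wr by auto
  have oe: "order c (wronskian p q) = e" using ow(2) Wr s by (simp add: order_smult)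
  show "order c (wronskian p q) \<le> d - 1" using oe e \<open>order c r \<le> d\<close> by simp
  assume "order c (wronskian p q) = d - 1"
  then have "order c r = d" using oe e deg by simp
  then show "\<exists>l m \<alpha>. \<alpha> \<noteq> 0 \<and> smult l p + smult m q = smult \<alpha> ([:- c, 1:] ^ d)"
    using max_order_power[OF r0 degr] r_def by metis
qed

lemma coeff_mult_top:
  fixes a b :: "complex poly"
  assumes "degree a \<le> n" "degree b \<le> Suc n"
  shows "coeff (a * b) (n + n) = coeff a n * coeff b n +
    (if n = 0 then 0 else coeff a (n - 1) * coeff b (Suc n))"
proof -
  have "coeff (a * b) (n + n) = (\<Sum>i\<le>n + n. coeff a i * coeff b (n + n - i))"
    by (rule coeff_mult)
  \<comment> \<open>The degree bounds leave only the index splits n + n and (n - 1) + (n + 1); for n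
    = 0 truncated subtraction would make them coincide.\<close>
  also have "\<dots> = (\<Sum>i\<in>(if n = 0 then {n} else {n - 1, n}). coeff a i * coeff b (n + n - i))"
  proof (rule sum.mono_neutral_right)
    show "\<forall>i\<in>{..n + n} - (if n = 0 then {n} else {n - 1, n}). coeff a i * coeff b (n + n - i) = 0"
    proof
      fix i assume i: "i \<in> {..n + n} - (if n = 0 then {n} else {n - 1, n})"
      then have "i > n \<or> n + n - i > Suc n" by (auto split: if_splits)
      then show "coeff a i * coeff b (n + n - i) = 0" using assms by (auto simp: coeff_eq_0)
    qed
  qed auto
  finally show ?thesis by (auto simp: algebra_simps)
qed

text \<open>With d = n + 1 this is the coefficient of degree 2d - 2. Up to sign it is the value in
  \<open>wronskian_hrev_0\<close>, so it is nonzero exactly when infinity is not critical.\<close>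

lemma coeff_wronskian_top:
  assumes "degree p \<le> Suc n" "degree q \<le> Suc n"
  shows "coeff (wronskian p q) (n + n) = coeff p (Suc n) * coeff q n - coeff p n * coeff q (Suc n)"
proof -
  have d: "degree (pderiv p) \<le> n" "degree (pderiv q) \<le> n"
    using assms by (simp_all add: degree_pderiv)
  have "coeff (wronskian p q) (n + n) = coeff (pderiv p * q) (n + n) - coeff (pderiv q * p) (n + n)"
    by (simp add: wronskian_def mult.commute)
  then show ?thesis
    unfolding coeff_mult_top[OF d(1) assms(2)] coeff_mult_top[OF d(2) assms(1)]
    by (cases n) (simp_all add: coeff_pderiv algebra_simps)
qed

lemma degree_eq_two_orders:
  fixes W :: "complex poly"
  assumes "W \<noteq> 0" "{z. poly W z = 0} = {c1, c2}" "c1 \<noteq> c2"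
  shows "degree W = order c1 W + order c2 W"
proof -
  have "degree W = size (proots W)" by (simp add: size_proots_complex)
  also have "\<dots> = (\<Sum>x\<in>{c1, c2}. order x W)"
    unfolding size_multiset_overloaded_eq using assms by simp
  finally show ?thesis using assms(3) by simp
qed

definition pw :: "nat \<Rightarrow> sphere \<Rightarrow> sphere" where
  "pw d z = hpt (hX z ^ d) (hY z ^ d)"

lemma pw_hpt:
  assumes "x \<noteq> 0 \<or> y \<noteq> 0" shows "pw d (hpt x y) = hpt (x ^ d) (y ^ d)"
proof -
  obtain k where k: "k \<noteq> 0" "x = k * hX (hpt x y)" "y = k * hY (hpt x y)"
    using hpt_coords[OF assms] by blast
  have "hpt (x ^ d) (y ^ d) = hpt (k ^ d * hX (hpt x y) ^ d) (k ^ d * hY (hpt x y) ^ d)"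
    by (subst k(2), subst k(3)) (simp add: power_mult_distrib)
  then show ?thesis using k(1) by (simp add: pw_def hpt_scale)
qed

text \<open>The Wronskian has degree \<open>2d - 2\<close> since infinity is not critical, and vanishes to order at
  most \<open>d - 1\<close> at each point; with only two zeros both orders equal \<open>d - 1\<close>.\<close>

lemma bicritical_normal_form_finite:
  assumes h: "hrep d p q" and crit: "{z. has_mult (hmap d p q) z 0} = {Some c1, Some c2}"
    and c: "c1 \<noteq> c2"
  obtains M where "mobius M" "hmap d p q = M \<circ> pw d \<circ> mob 1 (- c1) 1 (- c2)"
proof -
  let ?W = "wronskian p q"
  have deg: "degree p \<le> d" "degree q \<le> d" "1 \<le> d"
    and nz: "\<And>z. hev d p z \<noteq> 0 \<or> hev d q z \<noteq> 0" using h by (auto simp: hrep_def)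
  obtain n where n: "d = Suc n" using deg(3) by (cases d) auto
  have W0: "?W \<noteq> 0" by (rule order_wronskian_hrep(1)[OF h])
  have fin: "poly ?W a = 0 \<longleftrightarrow> a \<in> {c1, c2}" for a
  proof -
    obtain D where "has_mult (hmap d p q) (Some a) D" "D = 0 \<longleftrightarrow> poly ?W a = 0"
      using has_mult_hmap[OF h, of "Some a"] by auto
    then have "poly ?W a = 0 \<longleftrightarrow> Some a \<in> {z. has_mult (hmap d p q) z 0}"
      using has_mult_unique by auto
    then show ?thesis unfolding crit by auto
  qed
  obtain D where "has_mult (hmap d p q) None D"
    "D = 0 \<longleftrightarrow> poly (wronskian (hrev d p) (hrev d q)) 0 = 0"
    using has_mult_hmap[OF h, of None] by auto
  moreover have "None \<notin> {z. has_mult (hmap d p q) z 0}" unfolding crit by simp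
  ultimately have "poly (wronskian (hrev d p) (hrev d q)) 0 \<noteq> 0" by auto
  then have "coeff ?W (n + n) \<noteq> 0"
    using wronskian_hrev_0[OF h] coeff_wronskian_top[of p n q] deg by (auto simp: n)
  then have "n + n \<le> degree ?W" by (rule le_degree)
  also have "\<dots> = order c1 ?W + order c2 ?W"
    using fin c by (intro degree_eq_two_orders W0) auto
  finally have o: "order c1 ?W = d - 1" "order c2 ?W = d - 1"
    using order_wronskian_hrep(2)[OF h, of c1] order_wronskian_hrep(2)[OF h, of c2] by (auto simp: n)
  obtain l1 m1 \<alpha> where 1: "\<alpha> \<noteq> 0" "smult l1 p + smult m1 q = smult \<alpha> ([:- c1, 1:] ^ d)"
    using order_wronskian_hrep(3)[OF h o(1)] by blast
  obtain l2 m2 \<beta> where 2: "\<beta> \<noteq> 0" "smult l2 p + smult m2 q = smult \<beta> ([:- c2, 1:] ^ d)"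
    using order_wronskian_hrep(3)[OF h o(2)] by blast
  have ev: "l * hev d p z + m * hev d q z = \<gamma> * (hX z - e * hY z) ^ d"
    if eq: "smult l p + smult m q = smult \<gamma> ([:- e, 1:] ^ d)" for l m \<gamma> e z
  proof (cases z)
    case None
    have "coeff ([:- e, 1:] ^ d) d = 1"
      using lead_coeff_power[of "[:- e, 1:]" d] by (simp add: degree_power_eq)
    then show ?thesis using arg_cong[OF eq, of "\<lambda>r. coeff r d"] None by simp
  next
    case (Some a)
    then show ?thesis using arg_cong[OF eq, of "\<lambda>r. poly r a"] by simp
  qed
  \<comment> \<open>One combination vanishes at c1 but not at c2, the other at c2 but not at c1, so
    they are not proportional.\<close>
  have det: "l1 * m2 - m1 * l2 \<noteq> 0"
  proof
    assume 0: "l1 * m2 - m1 * l2 = 0"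
    have v: "l1 * poly p c1 + m1 * poly q c1 = 0" "l2 * poly p c1 + m2 * poly q c1 \<noteq> 0"
      "l1 * poly p c2 + m1 * poly q c2 \<noteq> 0" "l2 * poly p c2 + m2 * poly q c2 = 0"
      using ev[OF 1(2), of "Some c1"] ev[OF 2(2), of "Some c1"]
        ev[OF 1(2), of "Some c2"] ev[OF 2(2), of "Some c2"] 1(1) 2(1) c deg(3) by auto
    have "l1 * (l2 * poly p c1 + m2 * poly q c1) =
        l2 * (l1 * poly p c1 + m1 * poly q c1) + (l1 * m2 - m1 * l2) * poly q c1"
      "m1 * (l2 * poly p c1 + m2 * poly q c1) =
        m2 * (l1 * poly p c1 + m1 * poly q c1) - (l1 * m2 - m1 * l2) * poly p c1"
      by (simp_all add: algebra_simps)
    then have "l1 = 0" "m1 = 0" using v 0 by auto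
    then show False using v(3) by simp
  qed
  \<comment> \<open>N sends c1 to 0 and c2 to infinity. The matrix l1, m1, l2, m2 turns p/q into a
    constant multiple of N^d, and \<open>K\<close> undoes it.\<close>
  define N where "N = mob 1 (- c1) 1 (- c2)"
  obtain K where K: "mobius K" "K \<circ> mob l1 m1 l2 m2 = id"
    using mobius_inverse[OF mobius_mob[OF det]] by metis
  have ab: "\<alpha> * \<beta> - 0 * 0 \<noteq> 0" using 1(1) 2(1) by simp
  have main: "mob l1 m1 l2 m2 (hmap d p q z) = mob \<alpha> 0 0 \<beta> (pw d (N z))" for z
  proof -
    have n0: "hX z - c1 * hY z \<noteq> 0 \<or> hX z - c2 * hY z \<noteq> 0"
      using c by (cases z) auto
    have "mob l1 m1 l2 m2 (hmap d p q z) =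
        hpt (\<alpha> * (hX z - c1 * hY z) ^ d) (\<beta> * (hX z - c2 * hY z) ^ d)"
      unfolding hmap_def mob_hpt[OF nz] ev[OF 1(2)] ev[OF 2(2)] ..
    also have "\<dots> = mob \<alpha> 0 0 \<beta> (hpt ((hX z - c1 * hY z) ^ d) ((hX z - c2 * hY z) ^ d))"
      by (subst mob_hpt) (use n0 in auto)
    also have "hpt ((hX z - c1 * hY z) ^ d) ((hX z - c2 * hY z) ^ d) = pw d (N z)"
      using pw_hpt[OF n0] by (simp add: N_def mob_def)
    finally show ?thesis .
  qed
  have "K (mob l1 m1 l2 m2 w) = w" for w using K(2) by (metis comp_apply id_apply)
  then have "hmap d p q z = K (mob \<alpha> 0 0 \<beta> (pw d (N z)))" for z using main by metis
  then have "hmap d p q = (K \<circ> mob \<alpha> 0 0 \<beta>) \<circ> pw d \<circ> N" by auto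
  then show thesis using that mobius_comp[OF K(1) mobius_mob[OF ab]] N_def by blast
qed

text \<open>Precomposition with b + 1/z, performed on polynomials as a shift followed by a reversal.
  It sends infinity to b, so a noncritical b brings both critical points into the finite
  plane.\<close>

lemma hrep_shift_inverse:
  fixes b :: complex
  assumes "hrep d p q"
  defines "p' \<equiv> hrev d (p \<circ>\<^sub>p [:b, 1:])" and "q' \<equiv> hrev d (q \<circ>\<^sub>p [:b, 1:])"
  shows "hrep d p' q'" and "hmap d p' q' = hmap d p q \<circ> mob b 1 1 0"
proof -
  have deg: "degree p \<le> d" "degree q \<le> d" "1 \<le> d"
    and nz: "\<And>z. hev d p z \<noteq> 0 \<or> hev d q z \<noteq> 0" using assms by (auto simp: hrep_def)
  have shift: "degree (r \<circ>\<^sub>p [:b, 1:]) = degree r"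
    "coeff (r \<circ>\<^sub>p [:b, 1:]) d = coeff r d" if "degree r \<le> d" for r :: "complex poly"
  proof -
    show 1: "degree (r \<circ>\<^sub>p [:b, 1:]) = degree r" by (simp add: degree_pcompose)
    show "coeff (r \<circ>\<^sub>p [:b, 1:]) d = coeff r d"
    proof (cases "degree r = d")
      case True
      then show ?thesis using lead_coeff_comp[of "[:b, 1:]" r] 1 by simp
    next
      case False
      then show ?thesis using that 1 by (simp add: coeff_eq_0)
    qed
  qed
  \<comment> \<open>The factor is t^d, the homogeneity factor of forms of degree d, except at t = 0
    and at infinity, where it is 1.\<close>
  have ev: "\<exists>k. k \<noteq> 0 \<and> hev d p' z = k * hev d p (mob b 1 1 0 z) \<and> hev d q' z = k * hev d q (mob b 1 1 0 z)" for z
  proof (cases z)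
    case None
    have "hev d p' None = poly p b" "hev d q' None = poly q b"
      using deg shift by (simp_all add: p'_def q'_def coeff_hrev poly_0_coeff_0[symmetric] poly_pcompose)
    then show ?thesis using None by (intro exI[of _ 1]) (simp add: mob_def hpt_def)
  next
    case (Some t)
    show ?thesis
    proof (cases "t = 0")
      case True
      then show ?thesis using deg shift Some
        by (intro exI[of _ 1]) (simp add: mob_def hpt_def p'_def q'_def poly_hrev_0)
    next
      case False
      have "(b * t + 1) / t = b + 1 / t" using False by (simp add: field_simps)
      then show ?thesis using False deg shift Some
        by (intro exI[of _ "t ^ d"]) (simp add: mob_def hpt_def p'_def q'_def poly_hrev poly_pcompose)
    qed
  qed
  have nz': "hev d p' z \<noteq> 0 \<or> hev d q' z \<noteq> 0" for z
    using ev[of z] nz[of "mob b 1 1 0 z"] by auto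
  then show "hrep d p' q'" using deg shift degree_hrev by (simp add: hrep_def p'_def q'_def)
  show "hmap d p' q' = hmap d p q \<circ> mob b 1 1 0"
  proof
    fix z show "hmap d p' q' z = (hmap d p q \<circ> mob b 1 1 0) z"
      using ev[of z] by (auto simp: hmap_def hpt_scale)
  qed
qed

text \<open>The Wronskian of 1 + b z and z is the constant -1, and at infinity the reversed pair
  gives 1.\<close>

lemma has_mult_shift_inverse: "\<exists>E. E \<noteq> 0 \<and> has_mult (mob b 1 1 0) z E"
proof -
  let ?p = "[:1, b:]" and ?q = "[:0, 1:]"
  have h: "hrep 1 ?p ?q"
    unfolding hrep_def
  proof (intro conjI allI)
    fix z show "hev 1 ?p z \<noteq> 0 \<or> hev 1 ?q z \<noteq> 0" by (cases z) auto
  qed auto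
  have m: "hmap 1 ?p ?q = mob b 1 1 0"
  proof
    fix z show "hmap 1 ?p ?q z = mob b 1 1 0 z"
      by (cases z) (simp_all add: hmap_def mob_def add.commute mult.commute)
  qed
  obtain D where D: "has_mult (hmap 1 ?p ?q) z D" "D = 0 \<longleftrightarrow> (case z of
      Some a \<Rightarrow> poly (wronskian ?p ?q) a = 0
      | None \<Rightarrow> poly (wronskian (hrev 1 ?p) (hrev 1 ?q)) 0 = 0)"
    using has_mult_hmap[OF h] by metis
  have "D \<noteq> 0"
    unfolding D(2) using wronskian_hrev_0[OF h]
    by (cases z) (auto simp: wronskian_def pderiv_pCons)
  then show ?thesis using D(1) m by auto
qed

theorem bicritical_normal_form:
  assumes "bicritical f" "has_degree f d"
  obtains M N where "mobius M" "mobius N" "f = M \<circ> pw d \<circ> N"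
    "crit f = {z. N z = Some 0 \<or> N z = None}"
proof -
  obtain p q where h: "hrep d p q" and f: "f = hmap d p q"
    using has_degree_hmap assms(2) by metis
  have rat: "is_rational_map f" using assms(2) by (auto simp: has_degree_def is_rational_map_def)
  have "card (crit f) = 2" using assms(1) by (simp add: bicritical_def)
  then obtain e1 e2 where e: "crit f = {e1, e2}" "e1 \<noteq> e2" by (auto simp: card_2_iff)
  have "infinite (range (Some :: complex \<Rightarrow> sphere))"
    by (simp add: finite_image_iff infinite_UNIV_char_0)
  then have "\<not> range (Some :: complex \<Rightarrow> sphere) \<subseteq> {e1, e2}" using finite_subset by blast
  then obtain b where b: "Some b \<noteq> e1" "Some b \<noteq> e2" by blast
  define A where "A = mob b 1 1 0"
  have mA: "mobius A" unfolding A_def by (rule mobius_mob) simp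
  obtain B where B: "mobius B" "B \<circ> A = id" "A \<circ> B = id" using mobius_inverse[OF mA] by metis
  have BA: "B (A z) = z" "A (B z) = z" for z using B(2,3) by (metis comp_apply id_apply)+
  have "A None = Some b" by (simp add: A_def mob_def hpt_def)
  then have "B e1 \<noteq> None" "B e2 \<noteq> None" using b BA by metis+
  then obtain c1 c2 where c: "B e1 = Some c1" "B e2 = Some c2" by auto
  have "c1 \<noteq> c2" using c e(2) BA(2) by metis
  let ?p = "hrev d (p \<circ>\<^sub>p [:b, 1:])" and ?q = "hrev d (q \<circ>\<^sub>p [:b, 1:])"
  note hs = hrep_shift_inverse[OF h, of b]
  \<comment> \<open>By the chain rule, with the derivative of \<open>A\<close> never zero, the
    critical points of \<open>f \<circ> A\<close> are the preimages under \<open>A\<close> of those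
    of f.\<close>
  have "has_mult (hmap d ?p ?q) z 0 \<longleftrightarrow> A z \<in> crit f" for z
  proof -
    obtain E where E: "E \<noteq> 0" "has_mult A z E" using has_mult_shift_inverse A_def by blast
    obtain D where D: "has_mult f (A z) D" using has_mult_hmap[OF h] f by metis
    have "has_mult (hmap d ?p ?q) z (D * E)"
      using has_mult_comp[OF E(2) D] hs(2) f A_def by simp
    then have "has_mult (hmap d ?p ?q) z 0 \<longleftrightarrow> D = 0" using has_mult_unique E(1) by fastforce
    also have "\<dots> \<longleftrightarrow> has_mult f (A z) 0" using D has_mult_unique by blast
    finally show ?thesis using crit_iff_has_mult[OF rat] by blast
  qed
  then have "{z. has_mult (hmap d ?p ?q) z 0} = {Some c1, Some c2}"
    using e(1) c BA by (auto; metis)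
  then obtain M where M: "mobius M" "hmap d ?p ?q = M \<circ> pw d \<circ> mob 1 (- c1) 1 (- c2)"
    using bicritical_normal_form_finite[OF hs(1) _ \<open>c1 \<noteq> c2\<close>] by metis
  define L where "L = mob 1 (- c1) 1 (- c2)"
  have mL: "mobius L" unfolding L_def using \<open>c1 \<noteq> c2\<close> by (intro mobius_mob) simp
  have "f z = (M \<circ> pw d \<circ> (L \<circ> B)) z" for z
    using fun_cong[OF M(2), of "B z"] unfolding hs(2) f L_def A_def[symmetric] by (simp add: BA)
  then have 1: "f = M \<circ> pw d \<circ> (L \<circ> B)" by blast
  have L: "L w = Some 0 \<longleftrightarrow> w = Some c1" "L w = None \<longleftrightarrow> w = Some c2" for w
    using \<open>c1 \<noteq> c2\<close> by (cases w; auto simp: L_def mob_def hpt_def)+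
  have "crit f = {z. (L \<circ> B) z = Some 0 \<or> (L \<circ> B) z = None}"
    using e(1) c L BA by (auto; metis)
  then show thesis using that[OF M(1) mobius_comp[OF mL B(1)] 1] by blast
qed

section \<open>Fibres and deck rotations of a bicritical map\<close>

lemma pw_simps:
  assumes "1 \<le> d" shows "pw d (Some a) = Some (a ^ d)" "pw d None = None"
  using assms by (auto simp: pw_def hpt_def)

lemma card_pw_fibre:
  assumes "1 \<le> d" "w \<noteq> Some 0" "w \<noteq> None"
  shows "card (pw d -` {w}) = d"
proof -
  obtain a where a: "w = Some a" "a \<noteq> 0" using assms by (cases w) auto
  have "z \<in> pw d -` {w} \<longleftrightarrow> z \<in> Some ` {z. z ^ d = a}" for z
    using assms(1) by (cases z) (auto simp: pw_simps a)
  then have "pw d -` {w} = Some ` {z. z ^ d = a}" by blast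
  then show ?thesis using assms(1) a(2) by (simp add: card_image card_nth_roots)
qed

lemma pw_rotation:
  assumes "1 \<le> d" "\<zeta> ^ d = 1" shows "pw d (mob \<zeta> 0 0 1 w) = pw d w"
  using assms by (cases w) (auto simp: mob_def hpt_def pw_simps power_mult_distrib)

text \<open>In the normal form the critical points become 0 and infinity, each the sole preimage of
  itself under z^d.\<close>

lemma bicritical_fibre_crit:
  assumes "bicritical f" "has_degree f d" "c \<in> crit f" "f z = f c"
  shows "z = c"
proof -
  obtain M N where MN: "mobius M" "mobius N" "f = M \<circ> pw d \<circ> N"
    "crit f = {z. N z = Some 0 \<or> N z = None}" by (rule bicritical_normal_form[OF assms(1,2)])
  have d: "1 \<le> d" using assms(2) by (auto simp: has_degree_def rat_rep_def)
  have inj: "inj M" "inj N" using MN mobius_bij bij_is_inj by blast+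
  have "pw d (N z) = pw d (N c)" using assms(4) inj_eq[OF inj(1)] by (simp add: MN(3))
  moreover have "N c = Some 0 \<or> N c = None" using assms(3) by (simp add: MN(4))
  ultimately have "N z = N c" using d by (cases "N z") (auto simp: pw_simps power_0_left split: if_splits)
  then show ?thesis using inj(2) by (simp add: inj_eq)
qed

lemma bicritical_card_fibre:
  assumes "bicritical f" "has_degree f d" "x \<notin> crit_values f"
  shows "card (f -` {x}) = d"
proof -
  obtain M N where MN: "mobius M" "mobius N" "f = M \<circ> pw d \<circ> N"
    "crit f = {z. N z = Some 0 \<or> N z = None}" by (rule bicritical_normal_form[OF assms(1,2)])
  have d: "1 \<le> d" using assms(2) by (auto simp: has_degree_def rat_rep_def)
  have bij: "bij M" "bij N" using MN mobius_bij by blast+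
  obtain w where w: "x = M w" using bij_is_surj[OF bij(1)] by (auto simp: surj_def)
  have inM: "M u = M v \<longleftrightarrow> u = v" for u v using bij(1) by (simp add: bij_is_inj inj_eq)
  have nw: "w \<noteq> v" if v: "v = Some 0 \<or> v = None" for v
  proof
    assume "w = v"
    obtain c where c: "N c = v" using surjD[OF bij_is_surj[OF bij(2)], of v] by auto
    then have "c \<in> crit f" using v by (simp add: MN(4))
    moreover have "f c = x" using v c d by (auto simp: MN(3) pw_simps w \<open>w = v\<close> power_0_left)
    ultimately show False using assms(3) by (auto simp: crit_values_def)
  qed
  have "f -` {x} = N -` (pw d -` {w})" by (auto simp: MN(3) w inM)
  then have "card (f -` {x}) = card (pw d -` {w})"
    using bij(2) card_vimage_inj[of N "pw d -` {w}"] by (simp add: bij_is_inj bij_is_surj)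
  then show ?thesis using card_pw_fibre[OF d nw nw] by simp
qed

text \<open>Multiplication by a d-th root of unity, conjugated by \<open>N\<close>, is a deck
  transformation fixing both critical points.\<close>

lemma bicritical_rotations:
  assumes "bicritical f" "has_degree f d" "3 \<le> d"
  shows "\<exists>R \<subseteq> {\<tau> \<in> Deck f. \<forall>c\<in>crit f. \<tau> c = c}. card R = d"
    and "\<exists>\<tau>\<in>Deck f. \<tau> \<noteq> id \<and> \<tau> \<circ> \<tau> \<noteq> id"
proof -
  obtain M N where MN: "mobius M" "mobius N" "f = M \<circ> pw d \<circ> N"
    "crit f = {z. N z = Some 0 \<or> N z = None}" by (rule bicritical_normal_form[OF assms(1,2)])
  obtain L where L: "mobius L" "L \<circ> N = id" "N \<circ> L = id" using mobius_inverse[OF MN(2)] by metis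
  have LN: "L (N z) = z" "N (L z) = z" for z using L(2,3) by (metis comp_apply id_apply)+
  have d: "1 \<le> d" using assms(3) by simp
  define \<rho> where "\<rho> = (\<lambda>\<zeta>. L \<circ> mob \<zeta> 0 0 1 \<circ> N)"
  define U where "U = {\<zeta>::complex. \<zeta> ^ d = 1}"
  have cU: "card U = d" unfolding U_def using d by (intro card_roots_unity_eq) simp
  have \<rho>1: "\<rho> \<zeta> (L (Some a)) = L (Some (\<zeta> * a))" for \<zeta> a
    by (simp add: \<rho>_def LN mob_def hpt_def)
  have injL: "L u = L v \<longleftrightarrow> u = v" for u v using LN(2) by metis
  have inj: "inj_on \<rho> U"
  proof (rule inj_onI)
    fix \<zeta> \<eta> assume "\<rho> \<zeta> = \<rho> \<eta>"
    then have "\<rho> \<zeta> (L (Some 1)) = \<rho> \<eta> (L (Some 1))" by simp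
    then show "\<zeta> = \<eta>" by (simp add: \<rho>1 injL)
  qed
  have deck: "\<rho> \<zeta> \<in> Deck f" if "\<zeta> \<in> U" for \<zeta>
  proof -
    have z: "\<zeta> ^ d = 1" using that by (simp add: U_def)
    then have "\<zeta> \<noteq> 0" using d by (auto simp: power_0_left)
    then have "mobius (\<rho> \<zeta>)"
      unfolding \<rho>_def using L(1) MN(2) mobius_comp mobius_mob[of \<zeta> 1 0 0] by simp
    moreover have "(f \<circ> \<rho> \<zeta>) w = f w" for w
      by (simp add: MN(3) \<rho>_def LN pw_rotation[OF d z])
    ultimately show ?thesis by (auto simp: Deck_def)
  qed
  have "\<rho> \<zeta> c = c" if "\<zeta> \<in> U" "c \<in> crit f" for \<zeta> c
  proof -
    have "mob \<zeta> 0 0 1 (N c) = N c" using that MN(4) by (auto simp: mob_def hpt_def)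
    then show ?thesis by (simp add: \<rho>_def LN)
  qed
  then have "\<rho> ` U \<subseteq> {\<tau> \<in> Deck f. \<forall>c\<in>crit f. \<tau> c = c}" using deck by auto
  moreover have "card (\<rho> ` U) = d" using card_image[OF inj] cU by simp
  ultimately show "\<exists>R \<subseteq> {\<tau> \<in> Deck f. \<forall>c\<in>crit f. \<tau> c = c}. card R = d" by blast
  \<comment> \<open>Since d >= 3 there is a root of unity other than 1 and -1, and its rotation has
    order at least 3; this is tested at the point \<open>L (Some 1)\<close>.\<close>
  have "\<not> U \<subseteq> {1, - 1}"
  proof
    assume "U \<subseteq> {1, - 1}"
    then have "card U \<le> card {1, - 1 :: complex}" by (intro card_mono) auto
    also have "\<dots> \<le> 2" by (simp add: card_insert_if)
    finally show False using cU assms(3) by simp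
  qed
  then obtain \<zeta> where z: "\<zeta> \<in> U" "\<zeta> \<noteq> 1" "\<zeta> \<noteq> - 1" by blast
  then have "\<zeta> * \<zeta> \<noteq> 1" by (simp add: square_eq_1_iff)
  have "\<rho> \<zeta> (L (Some 1)) \<noteq> L (Some 1)" using z(2) \<rho>1[of \<zeta> 1] by (simp add: injL)
  moreover have "\<rho> \<zeta> (\<rho> \<zeta> (L (Some 1))) \<noteq> L (Some 1)"
    using \<open>\<zeta> * \<zeta> \<noteq> 1\<close> by (simp add: \<rho>1 injL)
  ultimately have "\<rho> \<zeta> \<noteq> id" "\<rho> \<zeta> \<circ> \<rho> \<zeta> \<noteq> id" by (metis comp_apply id_apply)+
  then show "\<exists>\<tau>\<in>Deck f. \<tau> \<noteq> id \<and> \<tau> \<circ> \<tau> \<noteq> id" using deck[OF z(1)] by blast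
qed

section \<open>Iterates of bicritical maps and their deck groups\<close>

lemma bicritical_finite_fibre:
  assumes "bicritical f" "has_degree f d"
  shows "finite (f -` {x})"
proof (cases "x \<in> crit_values f")
  case True
  then obtain c where c: "c \<in> crit f" "x = f c" by (auto simp: crit_values_def)
  then have "f -` {x} \<subseteq> {c}" using bicritical_fibre_crit[OF assms c(1)] by auto
  then show ?thesis using finite_subset by blast
next
  case False
  have "1 \<le> d" using assms(2) by (auto simp: has_degree_def rat_rep_def)
  then show ?thesis using bicritical_card_fibre[OF assms False] by (intro card_ge_0_finite) simp
qed

lemma bicritical_finite_iter_fibre:
  assumes "bicritical f" "has_degree f d"
  shows "finite S \<Longrightarrow> finite ((f ^^ k) -` S)"
proof (induction k arbitrary: S)
  case (Suc k)
  have "f -` S = (\<Union>x\<in>S. f -` {x})" by auto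
  then have "finite (f -` S)" using Suc.prems bicritical_finite_fibre[OF assms] by simp
  moreover have "(f ^^ Suc k) -` S = (f ^^ k) -` (f -` S)" by auto
  ultimately show ?case using Suc.IH by metis
qed simp

text \<open>If x is not among the first forward images of critical values, no point met on the way
  back from x is a critical value, so each step multiplies the count by d.\<close>

lemma bicritical_card_iter_fibre:
  assumes "bicritical f" "has_degree f d"
  shows "x \<notin> (\<Union>i<k. (f ^^ i) ` crit_values f) \<Longrightarrow> card ((f ^^ k) -` {x}) = d ^ k"
proof (induction k)
  case 0
  then show ?case by (simp add: vimage_def)
next
  case (Suc k)
  define T where "T = (f ^^ k) -` {x}"
  have cT: "card T = d ^ k" unfolding T_def using Suc by (intro Suc.IH) auto
  have fT: "finite T" unfolding T_def using bicritical_finite_iter_fibre[OF assms] by simp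
  have nT: "y \<notin> crit_values f" if "y \<in> T" for y
    using that Suc.prems by (auto simp: T_def)
  have "(f ^^ Suc k) -` {x} = (\<Union>y\<in>T. f -` {y})"
    by (auto simp: T_def funpow_Suc_right simp del: funpow.simps)
  also have "card \<dots> = (\<Sum>y\<in>T. card (f -` {y}))"
    using fT bicritical_finite_fibre[OF assms] by (intro card_UN_disjoint) auto
  also have "\<dots> = (\<Sum>y\<in>T. d)" using nT bicritical_card_fibre[OF assms] by (intro sum.cong) auto
  finally show ?case using cT by (simp del: funpow.simps)
qed

section \<open>Deck groups of iterates\<close>

lemma infinite_sphere: "infinite (UNIV :: sphere set)"
proof -
  have "infinite (range (Some :: complex \<Rightarrow> sphere))"
    by (simp add: finite_image_iff infinite_UNIV_char_0)
  then show ?thesis using finite_subset[OF subset_UNIV] by blast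
qed

text \<open>A deck transformation is determined by its values at infinity, 0 and 1, and these lie in
  three finite fibres.\<close>

lemma Deck_transformation_group:
  assumes "\<And>x. finite (F -` {x})"
  shows "finite_transformation_group (Deck F)"
proof
  let ?A = "F -` {F None} \<times> F -` {F (Some 0)} \<times> F -` {F (Some 1)}"
  let ?e = "\<lambda>\<tau>. (\<tau> None, \<tau> (Some 0), \<tau> (Some 1))"
  have "inj_on ?e (Deck F)"
  proof (rule inj_onI)
    fix \<sigma> \<tau> assume "\<sigma> \<in> Deck F" "\<tau> \<in> Deck F" "?e \<sigma> = ?e \<tau>"
    then show "\<sigma> = \<tau>"
      by (intro mobius_eqI[of \<sigma> \<tau> "{None, Some 0, Some 1}"]) (auto simp: Deck_def)
  qed
  moreover have "?e ` Deck F \<subseteq> ?A" unfolding Deck_def by (auto dest: fun_cong simp: fun_eq_iff)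
  moreover have "finite ?A" using assms by simp
  ultimately show "finite (Deck F)" using inj_on_finite by blast
  show "id \<in> Deck F" using mobius_id by (simp add: Deck_def)
  fix g assume g: "g \<in> Deck F"
  show "g \<circ> h \<in> Deck F" if "h \<in> Deck F" for h
    using g that mobius_comp by (auto simp: Deck_def simp flip: comp_assoc)
  obtain h where h: "mobius h" "h \<circ> g = id" "g \<circ> h = id"
    using mobius_inverse g by (auto simp: Deck_def)
  have "F \<circ> h = (F \<circ> g) \<circ> h" using g by (simp add: Deck_def)
  also have "\<dots> = F" using h(3) by (simp add: comp_assoc)
  finally show "\<exists>h\<in>Deck F. h \<circ> g = id" using h by (auto simp: Deck_def)
qed

lemma Deck_fixed_points:
  assumes "finite_transformation_group (Deck F)" "g \<in> Deck F" "g \<noteq> id"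
  shows "card {z. g z = z} = 2"
proof (rule mobius_fixed_points(3)[OF _ assms(3)])
  interpret finite_transformation_group "Deck F" by (rule assms(1))
  show "mobius g" using assms(2) by (simp add: Deck_def)
  have "g ^^ n \<in> Deck F" for n
  proof (induction n)
    case (Suc n)
    then show ?case unfolding funpow.simps by (rule comp_mem[OF assms(2)])
  qed (use id_mem in \<open>simp add: id_def\<close>)
  then show "finite (range (\<lambda>n. g ^^ n))" by (intro finite_subset[OF _ finite_G]) auto
qed

lemma card_Deck_dvd:
  assumes "bicritical f" "has_degree f d"
  shows "card (Deck (f ^^ k)) dvd d ^ k"
proof -
  let ?F = "f ^^ k"
  have fin: "finite (?F -` {x})" for x using bicritical_finite_iter_fibre[OF assms] by simp
  have G: "finite_transformation_group (Deck ?F)" by (rule Deck_transformation_group[OF fin])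
  interpret finite_transformation_group "Deck ?F" by (rule G)
  define X where "X = (\<Union>g\<in>Deck ?F - {id}. {z. g z = z})"
  have "finite {z. g z = z}" if "g \<in> Deck ?F - {id}" for g
    using Deck_fixed_points[OF G, of g] that by (intro card_ge_0_finite) auto
  then have finX: "finite X" unfolding X_def using finite_G by simp
  have "card (crit f) = 2" using assms(1) by (simp add: bicritical_def)
  then have "finite (crit_values f)" unfolding crit_values_def
    by (intro finite_imageI card_ge_0_finite) simp
  then have "finite ((\<Union>i<k. (f ^^ i) ` crit_values f) \<union> ?F ` X)" using finX by simp
  \<comment> \<open>Only finitely many values are excluded: those with too few preimages, and the
    images of points fixed by a nontrivial deck element.\<close>
  then obtain x where x: "x \<notin> (\<Union>i<k. (f ^^ i) ` crit_values f)" "x \<notin> ?F ` X"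
    using infinite_sphere ex_new_if_finite by (metis UnCI)
  have "card (Deck ?F) dvd card (?F -` {x})"
  proof (rule card_G_dvd_free[OF fin])
    fix z g assume z: "z \<in> ?F -` {x}" and g: "g \<in> Deck ?F"
    have "?F (g z) = ?F z" using g unfolding Deck_def by (metis (mono_tags, lifting) comp_apply mem_Collect_eq)
    then show "g z \<in> ?F -` {x}" using z by simp
    show "g = id" if "g z = z" using that z g x(2) by (auto simp: X_def)
  qed
  then show ?thesis using bicritical_card_iter_fibre[OF assms x(1)] by simp
qed

lemma Deck_subset_iter:
  assumes "1 \<le> k" shows "Deck f \<subseteq> Deck (f ^^ k)"
proof -
  obtain j where j: "k = Suc j" using assms by (cases k) auto
  have "f ^^ k = f ^^ j \<circ> f" unfolding j by (rule funpow_Suc_right)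
  then show ?thesis by (auto simp: Deck_def comp_assoc)
qed

theorem Deck_iter_fixed_points:
  assumes "bicritical f" "has_degree f d" "3 \<le> d" "1 \<le> k"
    and \<tau>: "\<tau> \<in> Deck (f ^^ k)" "\<tau> \<noteq> id" "\<tau> \<circ> \<tau> \<noteq> id"
  shows "{z. \<tau> z = z} = crit f"
proof -
  let ?F = "f ^^ k"
  have fin: "finite (?F -` {x})" for x using bicritical_finite_iter_fibre[OF assms(1,2)] by simp
  have G: "finite_transformation_group (Deck ?F)" by (rule Deck_transformation_group[OF fin])
  interpret finite_transformation_group "Deck ?F" by (rule G)
  note fix2 = Deck_fixed_points[OF G]
  have cc: "card (crit f) = 2" using assms(1) by (simp add: bicritical_def)
  obtain R where R: "R \<subseteq> {\<tau> \<in> Deck f. \<forall>c\<in>crit f. \<tau> c = c}" "card R = d"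
    using bicritical_rotations(1)[OF assms(1-3)] by blast
  have stab: "d \<le> stab_card c" if "c \<in> crit f" for c
  proof -
    have "R \<subseteq> {g \<in> Deck ?F. g c = c}" using R(1) that Deck_subset_iter[OF assms(4)] by blast
    then have "card R \<le> stab_card c"
      unfolding stab_card_def using finite_G by (intro card_mono) auto
    then show ?thesis using R(2) by simp
  qed
  obtain c where c: "c \<in> crit f" using cc by fastforce
  define Z where "Z = {z. 3 \<le> stab_card z}"
  \<comment> \<open>|G| divides d^k, and a prime dividing d^k divides d.\<close>
  have pd: "p dvd d" if "p dvd card (Deck ?F)" "prime p" for p :: nat
    using that card_Deck_dvd[OF assms(1,2), of k] by (meson dvd_trans prime_dvd_power)
  have pr: "prime (2::nat)" "prime (3::nat)" by simp_all
  have cZ: "card Z \<le> 2" unfolding Z_def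
    by (rule card_large_stabilizer[OF fix2 assms(3) stab[OF c]]) (use pd pr in blast)+
  have "Z \<subseteq> {z. 2 \<le> stab_card z}" by (auto simp: Z_def)
  then have finZ: "finite Z" using sum_stab_card(1)[OF fix2] finite_subset by blast
  have "crit f \<subseteq> Z" using stab assms(3) by (force simp: Z_def)
  then have critZ: "crit f = Z" using card_seteq[OF finZ] cc cZ by simp
  have "\<tau> \<circ> \<tau> \<noteq> \<tau>"
  proof
    assume e: "\<tau> \<circ> \<tau> = \<tau>"
    obtain h where "h \<circ> \<tau> = id" using left_inverse \<tau>(1) by blast
    then show False using e \<tau>(2) by (metis comp_assoc id_comp)
  qed
  \<comment> \<open>Three distinct elements that fix every fixed point of \<open>\<tau>\<close>, so
    these fixed points lie in \<open>Z\<close>. There are two of them and \<open>Z\<close> has at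
    most two points, hence equality.\<close>
  then have c3: "card {id, \<tau>, \<tau> \<circ> \<tau>} = 3" using \<tau>(2,3) by auto
  have "{z. \<tau> z = z} \<subseteq> Z"
  proof
    fix z assume "z \<in> {z. \<tau> z = z}"
    then have "{id, \<tau>, \<tau> \<circ> \<tau>} \<subseteq> {g \<in> Deck ?F. g z = z}" using id_mem comp_mem \<tau>(1) by auto
    then have "card {id, \<tau>, \<tau> \<circ> \<tau>} \<le> stab_card z"
      unfolding stab_card_def using finite_G by (intro card_mono) auto
    then show "z \<in> Z" using c3 by (simp add: Z_def)
  qed
  then show ?thesis using card_seteq[OF finZ] fix2[OF \<tau>(1,2)] cZ critZ by simp
qed

section \<open>Critical points of iterates\<close>

lemma has_mult_iter:
  assumes "has_degree f d"
  shows "\<exists>D. has_mult (f ^^ k) z D \<and> (D = 0 \<longleftrightarrow> (\<exists>i<k. (f ^^ i) z \<in> crit f))"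
proof (induction k)
  case 0
  show ?case using has_mult_id[of z] by (intro exI[of _ 1]) (simp add: id_def)
next
  case (Suc k)
  then obtain D where D: "has_mult (f ^^ k) z D" "D = 0 \<longleftrightarrow> (\<exists>i<k. (f ^^ i) z \<in> crit f)" by blast
  have rat: "is_rational_map f" using assms by (auto simp: has_degree_def is_rational_map_def)
  obtain p q where h: "hrep d p q" "f = hmap d p q" using has_degree_hmap[OF assms] by metis
  obtain E where E: "has_mult f ((f ^^ k) z) E" using has_mult_hmap[OF h(1)] h(2) by metis
  then have "E = 0 \<longleftrightarrow> (f ^^ k) z \<in> crit f"
    using crit_iff_has_mult[OF rat] has_mult_unique by blast
  \<comment> \<open>The derivatives along the orbit multiply, so the product vanishes exactly when
    the orbit has met a critical point.\<close>
  moreover have "has_mult (f ^^ Suc k) z (E * D)" using has_mult_comp[OF D(1) E] unfolding funpow.simps .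
  ultimately show ?case using D(2) by (intro exI[of _ "E * D"]) (auto simp: less_Suc_eq simp del: funpow.simps)
qed

lemma crit_iter:
  assumes "has_degree f d" "is_rational_map (f ^^ k)"
  shows "z \<in> crit (f ^^ k) \<longleftrightarrow> (\<exists>i<k. (f ^^ i) z \<in> crit f)"
  using has_mult_iter[OF assms(1), of k z] crit_iff_has_mult[OF assms(2)] has_mult_unique by metis

lemma noncritical_iter_preimage:
  assumes "bicritical f" "has_degree f d" "3 \<le> d"
  shows "x \<notin> crit_values f \<Longrightarrow> \<exists>z. (f ^^ k) z = x \<and> (\<forall>i<k. (f ^^ i) z \<notin> crit f)"
proof (induction k arbitrary: x)
  case (Suc k)
  have cc: "card (crit f) = 2" using assms(1) by (simp add: bicritical_def)
  then have "finite (crit f)" by (intro card_ge_0_finite) simp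
  then have V: "finite (crit_values f)" "card (crit_values f) \<le> 2"
    unfolding crit_values_def using cc card_image_le[of "crit f" f] by simp_all
  \<comment> \<open>The fibre has d >= 3 points, more than there are critical values. A preimage
    outside the critical values keeps the induction going; it is noncritical because x is not a
    critical value.\<close>
  have "\<not> f -` {x} \<subseteq> crit_values f"
    using card_mono[OF V(1), of "f -` {x}"] V(2) bicritical_card_fibre[OF assms(1,2) Suc.prems] assms(3)
    by auto
  then obtain y where y: "f y = x" "y \<notin> crit_values f" by auto
  then have "y \<notin> crit f" using Suc.prems by (auto simp: crit_values_def)
  moreover obtain z where "(f ^^ k) z = y" "\<forall>i<k. (f ^^ i) z \<notin> crit f" using Suc.IH[OF y(2)] by blast
  ultimately show ?case using y(1) by (intro exI[of _ z]) (auto simp: less_Suc_eq)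
qed simp

theorem mainTheorem5:
  fixes F f :: "sphere \<Rightarrow> sphere" and d k :: nat
  assumes "is_rational_map F"
    and "bicritical f" and "has_degree f d" and "d \<ge> 3"
    and "k \<ge> 1" and "f ^^ k = F"
  shows "(\<forall>\<tau>\<in>Deck F. (\<forall>n. 0 < n \<and> n < 3 \<longrightarrow> \<tau> ^^ n \<noteq> id) \<longrightarrow> {z. \<tau> z = z} = crit f)
       \<and> (\<exists>\<tau>\<in>Deck F. \<forall>n. 0 < n \<and> n < 3 \<longrightarrow> \<tau> ^^ n \<noteq> id)
       \<and> crit_values f = {x. F -` {x} \<subseteq> crit F}"
proof -
  have ord: "(\<forall>n. 0 < n \<and> n < 3 \<longrightarrow> \<tau> ^^ n \<noteq> id) \<longleftrightarrow> \<tau> \<noteq> id \<and> \<tau> \<circ> \<tau> \<noteq> id"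
    for \<tau> :: "sphere \<Rightarrow> sphere"
  proof -
    have "0 < n \<and> n < 3 \<longleftrightarrow> n = 1 \<or> n = 2" for n :: nat by auto
    then show ?thesis by (auto simp: numeral_2_eq_2)
  qed
  have crit: "z \<in> crit F \<longleftrightarrow> (\<exists>i<k. (f ^^ i) z \<in> crit f)" for z
    using crit_iter[OF assms(3)] assms(1,6) by metis
  obtain j where j: "k = Suc j" using assms(5) by (cases k) auto
  have "crit_values f = {x. F -` {x} \<subseteq> crit F}"
  proof (intro equalityI subsetI CollectI)
    fix x z assume "x \<in> crit_values f" and z: "z \<in> F -` {x}"
    then obtain c where c: "c \<in> crit f" "x = f c" by (auto simp: crit_values_def)
    \<comment> \<open>The fibre of f over a critical value is a single critical point, so the orbit
      of z must pass through it at time k - 1.\<close>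
    have "f ((f ^^ j) z) = f c" using z c(2) assms(6) j by auto
    then have "(f ^^ j) z = c" by (rule bicritical_fibre_crit[OF assms(2,3) c(1)])
    then show "z \<in> crit F" unfolding crit using c(1) j by blast
  next
    fix x assume x: "x \<in> {x. F -` {x} \<subseteq> crit F}"
    show "x \<in> crit_values f"
    proof (rule ccontr)
      assume "x \<notin> crit_values f"
      then obtain z where "(f ^^ k) z = x" "\<forall>i<k. (f ^^ i) z \<notin> crit f"
        using noncritical_iter_preimage[OF assms(2-4)] by blast
      then show False using x crit assms(6) by blast
    qed
  qed
  moreover have "\<exists>\<tau>\<in>Deck F. \<tau> \<noteq> id \<and> \<tau> \<circ> \<tau> \<noteq> id"
    using bicritical_rotations(2)[OF assms(2-4)] Deck_subset_iter[OF assms(5)] assms(6) by blast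
  moreover have "{z. \<tau> z = z} = crit f" if "\<tau> \<in> Deck F" "\<tau> \<noteq> id" "\<tau> \<circ> \<tau> \<noteq> id" for \<tau>
    using Deck_iter_fixed_points[OF assms(2-5)] that assms(6) by blast
  ultimately show ?thesis unfolding ord by blast
qed

end
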